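(* The pair correlation function $g_2$ of the sequence $(\mathcal{F}_Q)_{Q\ge1}$ of Farey fractions is given, for $\lambda>0$, by $$g_2(\lambda)=\frac{6}{\pi^2\lambda^2}\sum_{1\le k<\frac{\pi^2\lambda}{3}}\varphi(k)\log\frac{\pi^2\lambda}{3k};$$ that is, for every bounded interval $I\subset(0,\infty)$, the limit $\mathcal{R}^{(2)}(I)=\lim_{Q\to\infty}\mathcal{R}^{(2)}_{\mathcal{F}_Q}(I)$ exists and equals $\int_I g_2(\lambda)\,d\lambda$. Moreover, as $\lambda\to\infty$, $$g_2(\lambda)=1+O(\lambda^{-1}).$$
   Context: Farey fractions: for an integer $Q\ge1$, $\mathcal{F}_Q$ is the set of Farey fractions of order $Q$ in $[0,1]$, with the convention that $\#\mathcal{F}_Q=N_Q=\sum_{k=1}^Q\varphi(k)$, i.e. $\mathcal{F}_Q=\{a/q:1\le a\le q\le Q,\ \gcd(a,q)=1\}$. Here $\varphi$ is Euler's totient function. Pair correlation: for a finite set $F\subset[0,1]$ with $N$ elements and an interval $I\subset\mathbb{R}$, $$\mathcal{R}^{(2)}_F(I)=\frac1N\,\#\Big\{(x,y)\in F^2:\ x\ne y \text{ and } x-y\in\tfrac1N I+\mathbb{Z}\Big\}.$$ For an increasing sequence $(F_n)_n$ of finite subsets of $[0,1]$, the pair correlation measure is $\mathcal{R}^{(2)}(I)=\lim_n\mathcal{R}^{(2)}_{F_n}(I)$ (when the limit exists for every bounded interval $I$), and if $\mathcal{R}^{(2)}(I)=\int_I g_2(x)\,dx$ then $g_2$ is called the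 pair correlation function of $(F_n)_n$. An empty sum equals $0$. *)

theory Defs
  imports "HOL-Analysis.Analysis" "HOL-Number_Theory.Totient" "HOL-Library.Landau_Symbols"
begin

(* The fraction 0 is left out, so that farey Q has exactly
   totient 1 + ... + totient Q elements. *)
definition farey :: "nat \<Rightarrow> real set" where
  "farey Q = {real a / real q | a q. 1 \<le> a \<and> a \<le> q \<and> q \<le> Q \<and> coprime a q}"

(* With N = card F, the last conjunct says that x - y lies in (1/N) I + Z. *)
definition pair_correlation :: "real set \<Rightarrow> real set \<Rightarrow> real" where
  "pair_correlation F I =
     real (card {(x, y). x \<in> F \<and> y \<in> F \<and> x \<noteq> y \<and>
                         (\<exists>t\<in>I. \<exists>m::int. x - y = t / real (card F) + of_int m)}) / real (card F)"

(* g is the density of the pair correlation measure of the sequence F on the part S of the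
   real line: only bounded intervals contained in S are tested.  Integrability is required
   explicitly because the Lebesgue integral of a non-integrable function is 0 by convention. *)
definition pair_correlation_function_on ::
    "real set \<Rightarrow> (nat \<Rightarrow> real set) \<Rightarrow> (real \<Rightarrow> real) \<Rightarrow> bool" where
  "pair_correlation_function_on S F g \<longleftrightarrow>
     incseq F \<and> (\<forall>n. finite (F n) \<and> F n \<subseteq> {0..1}) \<and>
     (\<forall>I. is_interval I \<longrightarrow> bounded I \<longrightarrow> I \<subseteq> S \<longrightarrow>
        set_integrable lborel I g \<and>
        (\<lambda>n. pair_correlation (F n) I) \<longlonglongrightarrow> (LINT x:I|lborel. g x))"

definition farey_g2 :: "real \<Rightarrow> real" where
  "farey_g2 l = 6 / (pi\<^sup>2 * l\<^sup>2) *
     (\<Sum>k | 1 \<le> k \<and> real k < pi\<^sup>2 * l / 3. real (totient k) * ln (pi\<^sup>2 * l / (3 * real k)))"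

end

theory Submission
  imports Defs "HOL-Computational_Algebra.Squarefree"
begin

text \<open>
  Write \<open>N\<close> for the number of Farey fractions of order \<open>Q\<close>. Two fractions \<open>a / q\<close> and
  \<open>a' / q'\<close>, the second lifted from the circle to the right of the first, are at distance
  \<open>k / (q q')\<close>, where \<open>k = a' q - a q'\<close> is the determinant of the primitive vectors \<open>v = (q, a)\<close> and
  \<open>w = (q', a')\<close>. Since \<open>N\<close> is of order \<open>Q\<^sup>2\<close>, a distance of at most \<open>t / N\<close> leaves only
  boundedly many values of \<open>k\<close>. For fixed \<open>k\<close>, one completes \<open>v\<close> to a basis by a vector
  \<open>u = (p, b)\<close> such that \<open>w = j v + k u\<close> with \<open>1 \<le> j \<le> k\<close>; the primitivity of \<open>w\<close> amounts to
  \<open>j\<close> being prime to \<open>k\<close>, and the pair is determined by \<open>k\<close>, \<open>j\<close> and the coprime pair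
  \<open>(q, p)\<close> (\<open>card_farey_pairs\<close>). So the number of pairs at distance at most \<open>t / N\<close> is a finite sum
  of numbers of primitive lattice points in dilates of plane regions, bounded by the lines
  \<open>x = 0\<close>, \<open>x = 1\<close>, \<open>j x + k y = 0\<close>, \<open>j x + k y = 1\<close> and a hyperbola.

  These regions are convex, and in a bounded convex region the primitive points have density
  \<open>6 / \<pi>\<^sup>2\<close> (\<open>primitive_lattice_point_count\<close>); the same fact for a triangle gives
  \<open>N \<sim> 3 Q\<^sup>2 / \<pi>\<^sup>2\<close>. The area of a region depends on \<open>k\<close> but not on \<open>j\<close>, and summing over the
  \<open>totient k\<close> values of \<open>j\<close> yields the limit of the distribution function as an explicit sum over \<open>k\<close>
  (\<open>farey_gap_ratio_tendsto\<close>). Its derivative is \<open>farey_g2\<close> (\<open>farey_gap_limit_deriv\<close>).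

  For the behaviour at infinity, \<open>totient\<close> is expanded as the convolution of the Moebius function with the
  identity. This reduces the weighted sum of totients to the elementary sum of \<open>e ln (Y / e)\<close> over
  \<open>e \<le> Y\<close>, which is known up to \<open>O(sqrt Y)\<close>, and gives an error of order \<open>O(X)\<close>
  in \<open>sum_totient_ln_approx\<close>.
\<close>

section \<open>The Moebius function and averages over it\<close>

definition moebius_mu :: "nat \<Rightarrow> real" where
  "moebius_mu n = (if squarefree n then (-1) ^ card (prime_factors n) else 0)"

lemma abs_moebius_le: "\<bar>moebius_mu n\<bar> \<le> 1"
  by (simp add: moebius_mu_def)

lemma moebius_1 [simp]: "moebius_mu 1 = 1" "moebius_mu (Suc 0) = 1"
  by (simp_all add: moebius_mu_def)

lemma moebius_prime_mult:
  assumes "prime p" "\<not> p dvd d" "squarefree d"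
  shows "moebius_mu (p * d) = - moebius_mu d"
proof -
  have cop: "coprime p d" using assms by (simp add: prime_imp_coprime)
  have sq: "squarefree (p * d)"
    using assms cop squarefree_mult_coprime squarefree_prime by blast
  have "d > 0" using assms by (auto intro: Nat.gr0I)
  then have "prime_factors (p * d) = insert p (prime_factors d)"
    using assms by (simp add: prime_factors_product prime_prime_factors prime_gt_0_nat)
  moreover have "p \<notin> prime_factors d" using assms by auto
  ultimately show ?thesis using sq assms by (simp add: moebius_mu_def)
qed

text \<open>Only squarefree divisors count. For a fixed prime \<open>p\<close> dividing \<open>n\<close>, multiplication by \<open>p\<close> pairs
those that are prime to \<open>p\<close> with the remaining ones and reverses the sign of every term.\<close>
lemma sum_moebius_divisors:
  assumes "n > 0"
  shows "(\<Sum>d | d dvd n. moebius_mu d) = (if n = 1 then 1 else 0)"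
proof (cases "n = 1")
  case False
  then obtain p where p: "prime p" "p dvd n"
    using prime_factor_nat by blast
  define A where "A = {d. d dvd n \<and> squarefree d \<and> \<not> p dvd d}"
  have fin: "finite {d. d dvd n}" using assms by simp
  have finA: "finite A" by (rule finite_subset[OF _ fin]) (auto simp: A_def)
  have split: "{d. d dvd n \<and> squarefree d} = A \<union> (\<lambda>d. p * d) ` A"
  proof (intro equalityI subsetI)
    fix d assume d: "d \<in> {d. d dvd n \<and> squarefree d}"
    show "d \<in> A \<union> (\<lambda>d. p * d) ` A"
    proof (cases "p dvd d")
      case True
      then obtain e where e: "d = p * e" by blast
      have "squarefree e" "e dvd n" 
        using d e squarefree_mono[of e d] dvd_mult_right[of p e n] by auto
      moreover have "\<not> p dvd e"
      proof
        assume "p dvd e"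
        then have "p ^ 2 dvd d" using e by (simp add: power2_eq_square)
        then have "p dvd 1" using d squarefreeD by blast
        then show False using p by auto
      qed
      ultimately show ?thesis using e by (auto simp: A_def)
    qed (use d in \<open>auto simp: A_def\<close>)
  next
    fix d assume d: "d \<in> A \<union> (\<lambda>d. p * d) ` A"
    show "d \<in> {d. d dvd n \<and> squarefree d}"
    proof (cases "d \<in> A")
      case False
      with d obtain e where e: "d = p * e" "e \<in> A" by blast
      then have c: "coprime p e" using p by (auto simp: A_def prime_imp_coprime)
      then have "d dvd n" using e p by (auto simp: A_def divides_mult)
      moreover have "squarefree d"
        using e c p squarefree_mult_coprime squarefree_prime by (auto simp: A_def)
      ultimately show ?thesis by simp
    qed (auto simp: A_def)
  qed
  have inj: "inj_on (\<lambda>d. p * d) A" using p by (auto simp: inj_on_def prime_gt_0_nat)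
  have "(\<Sum>d | d dvd n. moebius_mu d) = (\<Sum>d | d dvd n \<and> squarefree d. moebius_mu d)"
    by (rule sum.mono_neutral_right) (use fin in \<open>auto simp: moebius_mu_def\<close>)
  also have "\<dots> = (\<Sum>d\<in>A. moebius_mu d) + (\<Sum>d\<in>(\<lambda>d. p * d) ` A. moebius_mu d)"
    unfolding split by (rule sum.union_disjoint) (use finA in \<open>auto simp: A_def\<close>)
  also have "(\<Sum>d\<in>(\<lambda>d. p * d) ` A. moebius_mu d) = (\<Sum>d\<in>A. - moebius_mu d)"
    unfolding sum.reindex[OF inj] o_def
    by (rule sum.cong) (use p in \<open>auto simp: A_def moebius_prime_mult\<close>)
  finally show ?thesis using False by (simp add: sum_negf)
qed simp

text \<open>The form of the previous identity used to sieve lattice points. The sum runs over a range of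
\<open>d\<close> that may be chosen independently of the point, so that sums over points and over \<open>d\<close> can be
exchanged.\<close>
lemma indicator_coprime_eq_sum_moebius:
  fixes m n :: int
  assumes "gcd m n \<noteq> 0" "gcd m n \<le> int D"
  shows "(if coprime m n then 1 else 0) = (\<Sum>d\<in>{d\<in>{1..D}. int d dvd m \<and> int d dvd n}. moebius_mu d)"
proof -
  define g where "g = nat (gcd m n)"
  have g: "g > 0" "int g = gcd m n" using assms by (simp_all add: g_def)
  have "{d\<in>{1..D}. int d dvd m \<and> int d dvd n} = {d. d dvd g}"
  proof (intro equalityI subsetI)
    fix d assume "d \<in> {d. d dvd g}"
    then have "d dvd g" by simp
    moreover have "d \<le> g" using calculation g by (simp add: dvd_imp_le)
    moreover have "d \<noteq> 0" using calculation g by auto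
    moreover have "int d dvd gcd m n" using calculation g by (metis int_dvd_int_iff)
    ultimately show "d \<in> {d\<in>{1..D}. int d dvd m \<and> int d dvd n}"
      using assms g by auto
  qed (auto simp flip: int_dvd_int_iff simp: g)
  then show ?thesis using sum_moebius_divisors[of g] g
    by (auto simp: coprime_iff_gcd_eq_1)
qed

lemma totient_eq_sum_moebius:
  assumes "n > 0"
  shows "real (totient n) = (\<Sum>d | d dvd n. moebius_mu d * real (n div d))"
proof -
  have fin: "finite {d. d dvd n}" using assms by simp
  have "real (totient n) = (\<Sum>a\<in>{1..n}. if coprime (int a) (int n) then 1 else 0)"
    by (simp add: totient_def totatives_def flip: sum.inter_filter) 
       (rule arg_cong[where f=card], auto)
  also have "\<dots> = (\<Sum>a\<in>{1..n}. \<Sum>d\<in>{d\<in>{1..n}. int d dvd int a \<and> int d dvd int n}. moebius_mu d)"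
    by (intro sum.cong refl indicator_coprime_eq_sum_moebius)
       (use assms in \<open>auto simp del: gcd_int_int_eq intro!: zdvd_imp_le\<close>)
  also have "\<dots> = (\<Sum>a\<in>{1..n}. \<Sum>d | d dvd n. if d dvd a then moebius_mu d else 0)"
    unfolding sum.inter_filter [OF fin, symmetric]
    by (intro sum.cong refl)
       (use assms in \<open>auto dest: dvd_imp_le simp: Suc_le_eq intro: Nat.gr0I\<close>)
  also have "\<dots> = (\<Sum>d | d dvd n. \<Sum>a\<in>{1..n}. if d dvd a then moebius_mu d else 0)"
    by (rule sum.swap)
  also have "\<dots> = (\<Sum>d | d dvd n. moebius_mu d * real (n div d))"
  proof (rule sum.cong[OF refl])
    fix d assume "d \<in> {d. d dvd n}"
    then obtain e where e: "n = d * e" by auto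
    have d: "d > 0" using assms e by auto
    have "{a\<in>{1..n}. d dvd a} = (\<lambda>i. d * i) ` {1..e}"
      using d by (auto simp: e)
    moreover have "card ((\<lambda>i. d * i) ` {1..e}) = e"
      by (subst card_image) (use d in \<open>auto simp: inj_on_def\<close>)
    ultimately show "(\<Sum>a\<in>{1..n}. if d dvd a then moebius_mu d else 0) = moebius_mu d * real (n div d)"
      using d e by (simp flip: sum.inter_filter)
  qed
  finally show ?thesis .
qed

text \<open>Summation of a Dirichlet convolution, by writing \<open>k = d m\<close>.\<close>
lemma sum_divisors_swap:
  fixes f :: "nat \<Rightarrow> nat \<Rightarrow> real"
  shows "(\<Sum>k\<in>{1..n}. \<Sum>d | d dvd k. f d (k div d)) = (\<Sum>d\<in>{1..n}. \<Sum>m\<in>{1..n div d}. f d m)"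
proof -
  have le: "b \<le> n" if "b * c \<le> n" "0 < c" for b c :: nat using that by (cases c) auto
  have "(\<Sum>k\<in>{1..n}. \<Sum>d | d dvd k. f d (k div d)) =
        (\<Sum>(k, d)\<in>(SIGMA k:{1..n}. {d. d dvd k}). f d (k div d))"
    by (rule sum.Sigma) auto
  also have "\<dots> = (\<Sum>(d, m)\<in>(SIGMA d:{1..n}. {1..n div d}). f d m)"
    by (rule sum.reindex_bij_witness[of _ "\<lambda>(d, m). (d * m, d)" "\<lambda>(k, d). (d, k div d)"])
       (auto simp: less_eq_div_iff_mult_less_eq mult.commute Suc_le_eq elim!: dvdE intro: le)
  also have "\<dots> = (\<Sum>d\<in>{1..n}. \<Sum>m\<in>{1..n div d}. f d m)"
    by (rule sum.Sigma [symmetric]) auto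
  finally show ?thesis .
qed

lemma summable_inverse_Suc_squares: "summable (\<lambda>n. 1 / real (Suc n) ^ 2)"
  using sums_summable[OF inverse_squares_sums] by (simp add: add.commute)

text \<open>Each dilate \<open>a (T / d)\<close> tends to \<open>A\<close>, and the series is dominated by a multiple of the sum of
the inverse squares, so Tannery's theorem allows passing to the limit term by term. A sieved count
of points is such an average of the unsieved counts at the scales \<open>T / d\<close>.\<close>
lemma tendsto_moebius_average:
  fixes a :: "real \<Rightarrow> real"
  assumes lim: "(a \<longlongrightarrow> A) at_top" and bound: "\<And>x. \<bar>a x\<bar> \<le> M"
  shows "((\<lambda>T. \<Sum>d. moebius_mu (Suc d) / real (Suc d) ^ 2 * a (T / real (Suc d)))
           \<longlongrightarrow> (\<Sum>d. moebius_mu (Suc d) / real (Suc d) ^ 2) * A) at_top"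
    and "summable (\<lambda>d. moebius_mu (Suc d) / real (Suc d) ^ 2)"
proof -
  let ?c = "\<lambda>d. moebius_mu (Suc d) / real (Suc d) ^ 2"
  have c: "\<bar>?c d\<bar> \<le> 1 / real (Suc d) ^ 2" for d
    using abs_moebius_le[of "Suc d"] by (simp add: divide_right_mono)
  show sc: "summable ?c"
    by (rule summable_comparison_test'[OF summable_inverse_Suc_squares]) (use c in auto)
  have M: "M \<ge> 0" using bound[of 0] by linarith
  have "((\<lambda>T. suminf (\<lambda>d. ?c d * a (T / real (Suc d)))) \<longlongrightarrow> suminf (\<lambda>d. ?c d * A)) at_top"
  proof (rule tannerys_theorem[THEN conjunct2, THEN conjunct2])
    show "((\<lambda>T. ?c d * a (T / real (Suc d))) \<longlongrightarrow> ?c d * A) at_top" for d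
    proof (intro tendsto_mult tendsto_const)
      have "filterlim (\<lambda>T::real. T / real (Suc d)) at_top at_top"
        using filterlim_tendsto_pos_mult_at_top[OF tendsto_const[of "inverse (real (Suc d))"] _ filterlim_ident]
        by (simp add: divide_inverse_commute)
      then show "((\<lambda>T. a (T / real (Suc d))) \<longlongrightarrow> A) at_top"
        by (rule filterlim_compose[OF lim])
    qed
    have "norm (?c d * a (T / real (Suc d))) \<le> M * (1 / real (Suc d) ^ 2)" for d T
      using mult_mono[OF c[of d] bound[of "T / real (Suc d)"]] M by (simp add: abs_mult mult.commute)
    then show "\<forall>\<^sub>F (d, T) in at_top \<times>\<^sub>F at_top. norm (?c d * a (T / real (Suc d))) \<le> M * (1 / real (Suc d) ^ 2)"
      by (intro always_eventually) auto
    show "summable (\<lambda>d. M * (1 / real (Suc d) ^ 2))"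
      by (rule summable_mult[OF summable_inverse_Suc_squares])
  qed simp
  then show "((\<lambda>T. \<Sum>d. ?c d * a (T / real (Suc d))) \<longlongrightarrow> (\<Sum>d. ?c d) * A) at_top"
    by (simp only: suminf_mult2[OF sc])
qed

text \<open>The value \<open>1 / \<zeta>(2)\<close>. Averaging the partial sums of \<open>\<zeta>(2)\<close> against the Moebius function gives
exactly \<open>1\<close> at every integer \<open>n > 0\<close>, since the products \<open>d m = k\<close> are collected with the weight
\<open>\<Sum>d | d dvd k. moebius_mu d\<close>; on the other hand the averages tend to the sum of the series times \<open>\<zeta>(2)\<close>.\<close>
lemma suminf_moebius_over_square: "(\<Sum>d. moebius_mu (Suc d) / real (Suc d) ^ 2) = 6 / pi\<^sup>2"
proof -
  define a where "a x = (\<Sum>m<nat \<lfloor>x\<rfloor>. 1 / real (Suc m) ^ 2)" for x :: real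
  have sums: "(\<lambda>m. 1 / real (Suc m) ^ 2) sums (pi\<^sup>2 / 6)"
    using inverse_squares_sums by (simp add: add.commute)
  have "filterlim (\<lambda>x::real. nat \<lfloor>x\<rfloor>) at_top at_top"
    by (intro filterlim_compose[OF filterlim_nat_sequentially] filterlim_floor_sequentially)
  then have lim: "(a \<longlongrightarrow> pi\<^sup>2 / 6) at_top"
    unfolding a_def using sums filterlim_compose unfolding sums_def by blast
  have bound: "\<bar>a x\<bar> \<le> pi\<^sup>2 / 6" for x
    unfolding a_def using sum_le_suminf[OF sums_summable[OF sums], of "{..<nat \<lfloor>x\<rfloor>}"] sums_unique[OF sums]
    by (simp add: sum_nonneg)
  have one: "(\<Sum>d. moebius_mu (Suc d) / real (Suc d) ^ 2 * a (real n / real (Suc d))) = 1" if "n > 0" for n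
  proof -
    have a_div: "a (real n / real d) = (\<Sum>m\<in>{1..n div d}. 1 / real m ^ 2)" for d
      unfolding a_def by (simp add: floor_divide_of_nat_eq sum.atLeast1_atMost_eq)
    have "(\<Sum>d. moebius_mu (Suc d) / real (Suc d) ^ 2 * a (real n / real (Suc d))) =
          (\<Sum>d<n. moebius_mu (Suc d) / real (Suc d) ^ 2 * a (real n / real (Suc d)))"
      by (rule suminf_finite) (auto simp: a_div simp del: of_nat_Suc)
    also have "\<dots> = (\<Sum>d\<in>{1..n}. \<Sum>m\<in>{1..n div d}. moebius_mu d / real (d * m) ^ 2)"
      by (subst sum.atLeast1_atMost_eq[of _ n, folded One_nat_def])
         (simp add: a_div sum_distrib_left power_mult_distrib del: of_nat_Suc mult_Suc)
    also have "\<dots> = (\<Sum>k\<in>{1..n}. \<Sum>d | d dvd k. moebius_mu d / real (d * (k div d)) ^ 2)"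
      by (rule sum_divisors_swap[symmetric])
    also have "\<dots> = (\<Sum>k\<in>{1..n}. (\<Sum>d | d dvd k. moebius_mu d) / real k ^ 2)"
      by (intro sum.cong refl) (auto simp: sum_divide_distrib)
    also have "\<dots> = (\<Sum>k\<in>{1..n}. if k = 1 then 1 else 0)"
      by (intro sum.cong refl) (auto simp: sum_moebius_divisors)
    finally show ?thesis using that by simp
  qed
  have "((\<lambda>n. \<Sum>d. moebius_mu (Suc d) / real (Suc d) ^ 2 * a (real n / real (Suc d)))
           \<longlongrightarrow> (\<Sum>d. moebius_mu (Suc d) / real (Suc d) ^ 2) * (pi\<^sup>2 / 6)) sequentially"
    by (rule filterlim_compose[OF tendsto_moebius_average(1)[OF lim bound] filterlim_real_sequentially])
  moreover have "((\<lambda>n. \<Sum>d. moebius_mu (Suc d) / real (Suc d) ^ 2 * a (real n / real (Suc d))) \<longlongrightarrow> 1) sequentially"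
    by (rule tendsto_eventually, rule eventually_mono[OF eventually_gt_at_top[of 0]], rule one)
  ultimately have "(\<Sum>d. moebius_mu (Suc d) / real (Suc d) ^ 2) * (pi\<^sup>2 / 6) = 1"
    using LIMSEQ_unique by blast
  then show ?thesis by (simp add: field_simps)
qed

section \<open>The behaviour of the density at infinity\<close>

text \<open>The precision is dictated by \<open>sum_mult_ln_nat_approx\<close>, where a factor of order \<open>1 / x\<^sup>2\<close> multiplies the
logarithm and the result must be correct up to \<open>O(x)\<close>.\<close>
lemma ln_1_plus_bounds:
  fixes x :: real
  assumes "0 \<le> x"
  shows "x - x\<^sup>2 / 2 \<le> ln (1 + x)" "ln (1 + x) \<le> x - x\<^sup>2 / 2 + x ^ 3 / 3"
proof -
  have "ln (1 + 0) - 0 + 0\<^sup>2 / 2 \<le> ln (1 + x) - x + x\<^sup>2 / 2"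
  proof (rule DERIV_nonneg_imp_nondecreasing[OF assms])
    fix y :: real assume y: "0 \<le> y" "y \<le> x"
    have "((\<lambda>x. ln (1 + x) - x + x\<^sup>2 / 2) has_real_derivative (1 / (1 + y) - 1 + y)) (at y)"
      using y by (auto intro!: derivative_eq_intros)
    moreover have "1 / (1 + y) - 1 + y = y\<^sup>2 / (1 + y)" using y by (simp add: field_simps power2_eq_square)
    ultimately show "\<exists>D. ((\<lambda>x. ln (1 + x) - x + x\<^sup>2 / 2) has_real_derivative D) (at y) \<and> 0 \<le> D"
      using y by auto
  qed
  then show "x - x\<^sup>2 / 2 \<le> ln (1 + x)" by simp
  have "0 - 0\<^sup>2 / 2 + 0 ^ 3 / 3 - ln (1 + 0) \<le> x - x\<^sup>2 / 2 + x ^ 3 / 3 - ln (1 + x)"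
  proof (rule DERIV_nonneg_imp_nondecreasing[OF assms])
    fix y :: real assume y: "0 \<le> y" "y \<le> x"
    have "((\<lambda>x. x - x\<^sup>2 / 2 + x ^ 3 / 3 - ln (1 + x)) has_real_derivative (1 - y + y\<^sup>2 - 1 / (1 + y))) (at y)"
      using y by (auto intro!: derivative_eq_intros)
    moreover have "1 - y + y\<^sup>2 - 1 / (1 + y) = y ^ 3 / (1 + y)"
      using y by (simp add: field_simps power2_eq_square power3_eq_cube)
    ultimately show "\<exists>D. ((\<lambda>x. x - x\<^sup>2 / 2 + x ^ 3 / 3 - ln (1 + x)) has_real_derivative D) (at y) \<and> 0 \<le> D"
      using y by auto
  qed
  then show "ln (1 + x) \<le> x - x\<^sup>2 / 2 + x ^ 3 / 3" by simp
qed

lemma sum_mult_ln_shift: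
  fixes Y :: real
  assumes "n > 0" "Y > 0"
  shows "(\<Sum>e\<in>{1..n}. real e * ln (Y / real e)) =
         (\<Sum>e\<in>{1..n}. real e * ln (real n / real e)) + real n * (real n + 1) / 2 * ln (Y / real n)"
proof -
  have "(\<Sum>e\<in>{1..n}. real e * ln (Y / real e)) =
        (\<Sum>e\<in>{1..n}. real e * ln (real n / real e) + real e * ln (Y / real n))"
    by (intro sum.cong refl) (use assms in \<open>auto simp: ln_div algebra_simps\<close>)
  also have "\<dots> = (\<Sum>e\<in>{1..n}. real e * ln (real n / real e)) + (\<Sum>e\<in>{1..n}. real e) * ln (Y / real n)"
    by (simp add: sum.distrib sum_distrib_right)
  also have "(\<Sum>e\<in>{1..n}. real e) = real n * (real n + 1) / 2"
    by (induction n) (auto simp: field_simps)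
  finally show ?thesis .
qed

text \<open>Raising \<open>n\<close> by one changes the left-hand difference by \<open>O(1 / n)\<close>. The errors therefore add up to
\<open>O(ln n)\<close>; the weaker bound by a square root is stable under induction with constant \<open>1\<close> and is
all that the sum over \<open>d\<close> in \<open>sum_totient_ln_approx\<close> requires.\<close>
lemma sum_mult_ln_nat_approx:
  "\<bar>(\<Sum>e\<in>{1..n}. real e * ln (real n / real e)) - (real n)\<^sup>2 / 4\<bar> \<le> sqrt (real n)"
proof (induction n)
  case (Suc n)
  let ?L = "\<lambda>n. \<Sum>e\<in>{1..n}. real e * ln (real n / real e)"
  show ?case
  proof (cases "n = 0")
    case False
    define N where "N = real n"
    have N: "N \<ge> 1" using False by (simp add: N_def)
    have eq: "?L (Suc n) = ?L n + N * (N + 1) / 2 * ln (1 + 1 / N)"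
    proof -
      have "?L (Suc n) = (\<Sum>e\<in>{1..n}. real e * ln (real (Suc n) / real e))"
        by (simp del: of_nat_Suc)
      also have "\<dots> = ?L n + N * (N + 1) / 2 * ln (real (Suc n) / N)"
        using sum_mult_ln_shift[of n "real (Suc n)"] False by (simp only: N_def)
      also have "real (Suc n) / N = 1 + 1 / N" using N by (simp add: N_def field_simps)
      finally show ?thesis .
    qed
    have "N * (N + 1) / 2 * ln (1 + 1 / N) \<ge> N * (N + 1) / 2 * (1 / N - (1 / N)\<^sup>2 / 2)"
      using ln_1_plus_bounds(1)[of "1 / N"] N by (intro mult_left_mono) auto
    also have "N * (N + 1) / 2 * (1 / N - (1 / N)\<^sup>2 / 2) = ((N + 1)\<^sup>2 - N\<^sup>2) / 4 - 1 / (4 * N)"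
      using N by (simp add: field_simps power2_eq_square)
    finally have lo: "N * (N + 1) / 2 * ln (1 + 1 / N) \<ge> ((N + 1)\<^sup>2 - N\<^sup>2) / 4 - 1 / (4 * N)" .
    have "N * (N + 1) / 2 * ln (1 + 1 / N) \<le> N * (N + 1) / 2 * (1 / N - (1 / N)\<^sup>2 / 2 + (1 / N) ^ 3 / 3)"
      using ln_1_plus_bounds(2)[of "1 / N"] N by (intro mult_left_mono) auto
    also have "\<dots> = ((N + 1)\<^sup>2 - N\<^sup>2) / 4 - 1 / (4 * N) + (N + 1) / (6 * N\<^sup>2)"
      using N by (simp add: field_simps power2_eq_square power3_eq_cube)
    also have "(N + 1) / (6 * N\<^sup>2) \<le> 1 / (2 * N)"
      using N by (simp add: field_simps power2_eq_square)
    finally have up: "N * (N + 1) / 2 * ln (1 + 1 / N) \<le> ((N + 1)\<^sup>2 - N\<^sup>2) / 4 + 1 / (4 * N)"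
      using N by (simp add: field_simps)
    \<comment> \<open>The error of one step is at most the increment of the square root.\<close>
    have "sqrt (N + 1) + sqrt N \<le> 4 * N"
    proof -
      have "sqrt (N + 1) \<le> N + 1" "sqrt N \<le> N" using N by (auto intro!: real_le_lsqrt simp: power2_eq_square)
      then show ?thesis using N by linarith
    qed
    moreover have "(sqrt (N + 1) + sqrt N) * (sqrt (N + 1) - sqrt N) = 1"
      using N by (simp add: algebra_simps)
    moreover have "sqrt (N + 1) - sqrt N \<ge> 0" by simp
    ultimately have "1 \<le> 4 * N * (sqrt (N + 1) - sqrt N)"
      by (metis mult_right_mono)
    then have "1 / (4 * N) \<le> sqrt (N + 1) - sqrt N" using N by (simp add: field_simps)
    with lo up Suc.IH eq show ?thesis unfolding N_def by (simp add: add.commute diff_divide_distrib)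
  qed simp
qed simp

lemma sum_mult_ln_approx:
  fixes Y :: real
  assumes "Y \<ge> 1"
  shows "\<bar>(\<Sum>e\<in>{1..nat \<lfloor>Y\<rfloor>}. real e * ln (Y / real e)) - Y\<^sup>2 / 4\<bar> \<le> 2 * sqrt Y"
proof -
  define n where "n = nat \<lfloor>Y\<rfloor>"
  define N where "N = real n"
  define x where "x = Y / N - 1"
  have "\<lfloor>Y\<rfloor> \<ge> 1" using assms by simp
  then have n: "N \<le> Y" "Y < N + 1" "N \<ge> 1" "n > 0" unfolding N_def n_def by linarith+
  have Y: "Y = N * (1 + x)" using n by (simp add: x_def)
  have "N * x = Y - N" using n by (simp add: x_def field_simps)
  then have x: "0 \<le> x" "N * x \<le> 1" using n by (auto simp: x_def)
  have Nx2: "(N * x)\<^sup>2 \<le> 1" "(N * x) * x \<le> 1"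
  proof -
    have "x \<le> N * x" using x n by (simp add: mult_le_cancel_right1)
    then have "x \<le> 1" using x by linarith
    then show "(N * x)\<^sup>2 \<le> 1" "(N * x) * x \<le> 1"
      using x n by (auto intro!: power_le_one mult_le_one)
  qed
  have aux: "\<bar>z - w\<bar> \<le> 1" if "(A + B) / 2 - (C + D) / 4 \<le> z" "z \<le> (A + B) / 2"
    "w = A / 2 + C / 4" "0 \<le> B" "B \<le> 1" "0 \<le> C" "C \<le> 1" "D \<le> 1" for z w A B C D :: real
    using that by (simp add: abs_le_iff field_simps)
  have "N * (N + 1) / 2 * ln (1 + x) \<ge> N * (N + 1) / 2 * (x - x\<^sup>2 / 2)"
    using ln_1_plus_bounds(1)[of x] n x by (intro mult_left_mono) auto
  also have "N * (N + 1) / 2 * (x - x\<^sup>2 / 2) = (N * (N * x) + N * x) / 2 - ((N * x)\<^sup>2 + N * x * x) / 4"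
    by (simp add: field_simps power2_eq_square)
  finally have lo: "(N * (N * x) + N * x) / 2 - ((N * x)\<^sup>2 + N * x * x) / 4 \<le> N * (N + 1) / 2 * ln (1 + x)" .
  have "N * (N + 1) / 2 * ln (1 + x) \<le> N * (N + 1) / 2 * x"
    using ln_add_one_self_le_self[of x] n x by (intro mult_left_mono) auto
  also have "N * (N + 1) / 2 * x = (N * (N * x) + N * x) / 2"
    by (simp add: field_simps)
  finally have up: "N * (N + 1) / 2 * ln (1 + x) \<le> (N * (N * x) + N * x) / 2" .
  have "\<bar>N * (N + 1) / 2 * ln (1 + x) - (Y\<^sup>2 - N\<^sup>2) / 4\<bar> \<le> 1"
  proof (rule aux[OF lo up])
    show "(Y\<^sup>2 - N\<^sup>2) / 4 = N * (N * x) / 2 + (N * x)\<^sup>2 / 4"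
      unfolding Y by (simp add: field_simps power2_eq_square)
  qed (use n x Nx2 in auto)
  moreover have "(\<Sum>e\<in>{1..n}. real e * ln (Y / real e)) =
      (\<Sum>e\<in>{1..n}. real e * ln (real n / real e)) + N * (N + 1) / 2 * ln (1 + x)"
    using sum_mult_ln_shift[of n Y] n by (simp add: N_def x_def)
  moreover note sum_mult_ln_nat_approx[of n]
  moreover have "sqrt N \<le> sqrt Y" "1 \<le> sqrt Y" using n by auto
  moreover have "\<bar>S - y / 4\<bar> \<le> 2 * t"
    if "\<bar>U - (y - m) / 4\<bar> \<le> 1" "S = L + U" "\<bar>L - m / 4\<bar> \<le> s" "s \<le> t" "1 \<le> t"
    for S L U y m s t :: real
    using that by (simp add: abs_le_iff diff_divide_distrib)
  ultimately show ?thesis unfolding n_def[symmetric] N_def by blast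
qed

lemma sum_inverse_sqrt_le: "(\<Sum>d\<in>{1..n}. 1 / sqrt (real d)) \<le> 2 * sqrt (real n)"
proof (induction n)
  case (Suc n)
  have "(sqrt (real n + 1) + sqrt (real n)) * (sqrt (real n + 1) - sqrt (real n)) = 1"
    by (simp add: algebra_simps)
  moreover have "(sqrt (real n + 1) + sqrt (real n)) * (sqrt (real n + 1) - sqrt (real n))
     \<le> (2 * sqrt (real n + 1)) * (sqrt (real n + 1) - sqrt (real n))"
    by (intro mult_right_mono) auto
  ultimately have "1 / sqrt (real n + 1) \<le> 2 * (sqrt (real n + 1) - sqrt (real n))"
    by (simp add: field_simps)
  then show ?case using Suc by (simp add: add.commute)
qed simp

text \<open>The tail is dominated by the telescoping series of \<open>1 / d - 1 / (d + 1)\<close>.\<close>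
lemma moebius_partial_sum_approx:
  assumes "n > 0"
  shows "\<bar>(\<Sum>d\<in>{1..n}. moebius_mu d / real d ^ 2) - 6 / pi\<^sup>2\<bar> \<le> 1 / real n"
proof -
  let ?c = "\<lambda>d. moebius_mu (Suc d) / real (Suc d) ^ 2"
  have sc: "summable ?c"
    by (rule tendsto_moebius_average(2)[of "\<lambda>_. 0" 0 0]) auto
  have tele: "(\<lambda>i. 1 / real (i + n) - 1 / real (Suc i + n)) sums (1 / real (0 + n) - 0)"
    by (rule telescope_sums'[OF LIMSEQ_ignore_initial_segment[OF lim_1_over_n, of n]])
  have c: "norm (?c (i + n)) \<le> 1 / real (i + n) - 1 / real (Suc i + n)" for i
  proof -
    have "norm (?c (i + n)) \<le> 1 / real (Suc (i + n)) ^ 2"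
      using abs_moebius_le[of "Suc (i + n)"] by (simp add: divide_right_mono)
    also have "\<dots> \<le> 1 / (real (i + n) * real (Suc (i + n)))"
      unfolding power2_eq_square using assms by (intro frac_le mult_right_mono) auto
    also have "\<dots> = 1 / real (i + n) - 1 / real (Suc i + n)"
      using assms by (simp add: field_simps)
    finally show ?thesis .
  qed
  have "norm (\<Sum>i. ?c (i + n)) \<le> (\<Sum>i. 1 / real (i + n) - 1 / real (Suc i + n))"
    by (rule norm_suminf_le[OF c sums_summable[OF tele]])
  then have "\<bar>\<Sum>i. ?c (i + n)\<bar> \<le> 1 / real n" using sums_unique[OF tele] by simp
  moreover have "6 / pi\<^sup>2 = (\<Sum>i. ?c (i + n)) + (\<Sum>d\<in>{1..n}. moebius_mu d / real d ^ 2)"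
    unfolding suminf_moebius_over_square[symmetric] sum.atLeast1_atMost_eq[of _ n, folded One_nat_def]
    using suminf_split_initial_segment[OF sc, of n] by simp
  ultimately show ?thesis by simp
qed

text \<open>Partial summation from the summatory function of \<open>totient\<close>, with its elementary error term
\<open>O(X ln X)\<close>, would lose a logarithm.
Instead \<open>totient k\<close> is written as \<open>\<Sum>d | d dvd k. moebius_mu d * (k / d)\<close>, which turns the sum into
\<open>\<Sum>d. moebius_mu d * S (X / d)\<close> with \<open>S Y = Y\<^sup>2 / 4 + O(sqrt Y)\<close>. The main terms give the partial sums of
\<open>1 / \<zeta>(2)\<close>, and the error terms \<open>sqrt (X / d)\<close> sum to \<open>O(X)\<close>.\<close>
lemma sum_totient_ln_approx:
  fixes X :: real
  assumes "X \<ge> 1"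
  shows "\<bar>(\<Sum>k\<in>{1..nat \<lfloor>X\<rfloor>}. real (totient k) * ln (X / real k)) - 3 * X\<^sup>2 / (2 * pi\<^sup>2)\<bar> \<le> 5 * X"
proof -
  define n where "n = nat \<lfloor>X\<rfloor>"
  have "\<lfloor>X\<rfloor> \<ge> 1" using assms by simp
  then have n: "real n \<le> X" "X < real n + 1" "n > 0" "real n \<ge> 1" unfolding n_def by linarith+
  define S where "S Y = (\<Sum>e\<in>{1..nat \<lfloor>Y\<rfloor>}. real e * ln (Y / real e))" for Y :: real
  have "(\<Sum>k\<in>{1..n}. real (totient k) * ln (X / real k)) =
        (\<Sum>k\<in>{1..n}. \<Sum>d | d dvd k. moebius_mu d * real (k div d) * ln (X / real (d * (k div d))))"
    by (intro sum.cong refl) (auto simp: totient_eq_sum_moebius sum_distrib_right)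
  also have "\<dots> = (\<Sum>d\<in>{1..n}. \<Sum>e\<in>{1..n div d}. moebius_mu d * real e * ln (X / real (d * e)))"
    by (rule sum_divisors_swap)
  also have "\<dots> = (\<Sum>d\<in>{1..n}. moebius_mu d * S (X / real d))"
  proof (intro sum.cong refl)
    fix d assume "d \<in> {1..n}"
    have "nat \<lfloor>X / real d\<rfloor> = n div d"
      using assms unfolding n_def
      by (metis floor_divide_real_eq_div nat_div_distrib' nat_int of_int_of_nat_eq of_nat_0_le_iff)
    then show "(\<Sum>e\<in>{1..n div d}. moebius_mu d * real e * ln (X / real (d * e))) = moebius_mu d * S (X / real d)"
      by (simp add: S_def sum_distrib_left mult.assoc)
  qed
  finally have V: "(\<Sum>k\<in>{1..n}. real (totient k) * ln (X / real k)) = (\<Sum>d\<in>{1..n}. moebius_mu d * S (X / real d))" .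
  define m where "m = (\<Sum>d\<in>{1..n}. moebius_mu d / real d ^ 2)"
  have main: "(\<Sum>d\<in>{1..n}. moebius_mu d * ((X / real d)\<^sup>2 / 4)) = X\<^sup>2 / 4 * m"
    by (simp add: m_def sum_distrib_left power_divide mult_ac)
  have "\<bar>(\<Sum>d\<in>{1..n}. moebius_mu d * S (X / real d)) - X\<^sup>2 / 4 * m\<bar>
      = \<bar>\<Sum>d\<in>{1..n}. moebius_mu d * (S (X / real d) - (X / real d)\<^sup>2 / 4)\<bar>"
    unfolding main[symmetric] by (simp add: sum_subtractf right_diff_distrib)
  also have "\<dots> \<le> (\<Sum>d\<in>{1..n}. \<bar>moebius_mu d * (S (X / real d) - (X / real d)\<^sup>2 / 4)\<bar>)"
    by (rule sum_abs)
  also have "\<dots> \<le> (\<Sum>d\<in>{1..n}. 2 * sqrt X * (1 / sqrt (real d)))"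
  proof (rule sum_mono)
    fix d assume d: "d \<in> {1..n}"
    have "\<bar>moebius_mu d * (S (X / real d) - (X / real d)\<^sup>2 / 4)\<bar> \<le> 1 * (2 * sqrt (X / real d))"
      unfolding abs_mult S_def using d n 
      by (intro mult_mono abs_moebius_le sum_mult_ln_approx) auto
    then show "\<bar>moebius_mu d * (S (X / real d) - (X / real d)\<^sup>2 / 4)\<bar> \<le> 2 * sqrt X * (1 / sqrt (real d))"
      by (simp add: real_sqrt_divide)
  qed
  also have "\<dots> = 2 * sqrt X * (\<Sum>d\<in>{1..n}. 1 / sqrt (real d))"
    by (simp add: sum_distrib_left)
  also have "\<dots> \<le> 2 * sqrt X * (2 * sqrt X)"
    using n assms by (intro mult_left_mono order_trans[OF sum_inverse_sqrt_le]) auto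
  also have "\<dots> = 4 * X" using assms by simp
  finally have 1: "\<bar>(\<Sum>d\<in>{1..n}. moebius_mu d * S (X / real d)) - X\<^sup>2 / 4 * m\<bar> \<le> 4 * X" .
  have "\<bar>X\<^sup>2 / 4 * m - 3 * X\<^sup>2 / (2 * pi\<^sup>2)\<bar> = X\<^sup>2 / 4 * \<bar>m - 6 / pi\<^sup>2\<bar>"
    by (subst abs_mult_pos') (auto simp: algebra_simps)
  also have "\<dots> \<le> X\<^sup>2 / 4 * (2 / X)"
  proof (intro mult_left_mono)
    have "\<bar>m - 6 / pi\<^sup>2\<bar> \<le> 1 / real n" unfolding m_def by (rule moebius_partial_sum_approx) (use n in auto)
    also have "\<dots> \<le> 2 / X"
    proof -
      have "X \<le> 2 * real n" using n by linarith
      then show ?thesis using divide_left_mono[of X "2 * real n" 2] n assms by simp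
    qed
    finally show "\<bar>m - 6 / pi\<^sup>2\<bar> \<le> 2 / X" .
  qed simp
  also have "\<dots> \<le> X" using assms by (simp add: power2_eq_square)
  finally show ?thesis using 1 unfolding n_def[symmetric] V by linarith
qed

text \<open>With \<open>X = \<pi>\<^sup>2 l / 3\<close>, the density is \<open>2 \<pi>\<^sup>2 / (3 X\<^sup>2)\<close> times the sum estimated above, and the main
term becomes \<open>1\<close>.\<close>
lemma farey_g2_bigo: "(\<lambda>l. farey_g2 l - 1) \<in> O[at_top](\<lambda>l. 1 / l)"
proof (rule bigoI[of _ 10])
  have "\<bar>farey_g2 l - 1\<bar> \<le> 10 * \<bar>1 / l\<bar>" if l: "l \<ge> 1" for l
  proof -
    define X where "X = pi\<^sup>2 * l / 3"
    define V where "V = (\<Sum>k\<in>{1..nat \<lfloor>X\<rfloor>}. real (totient k) * ln (X / real k))"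
    have pi3: "pi\<^sup>2 \<ge> 9" using pi_gt3 power_mono[of 3 pi 2] by simp
    have X: "X \<ge> 1" unfolding X_def using mult_mono[OF pi3 l] by simp
    have "(\<Sum>k | 1 \<le> k \<and> real k < X. real (totient k) * ln (X / real k)) = V"
      unfolding V_def
    proof (rule sum.mono_neutral_left)
      show "\<forall>k\<in>{1..nat \<lfloor>X\<rfloor>} - {k. 1 \<le> k \<and> real k < X}. real (totient k) * ln (X / real k) = 0"
      proof
        fix k assume k: "k \<in> {1..nat \<lfloor>X\<rfloor>} - {k. 1 \<le> k \<and> real k < X}"
        then have "real k = X" using X by (auto simp: le_nat_floor) linarith
        then show "real (totient k) * ln (X / real k) = 0" using X by simp
      qed
    qed (use X in \<open>auto simp: le_nat_iff le_floor_iff\<close>)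
    then have g: "farey_g2 l = 6 / (pi\<^sup>2 * l\<^sup>2) * V"
      unfolding farey_g2_def X_def by (simp add: field_simps)
    have "farey_g2 l - 1 = 6 / (pi\<^sup>2 * l\<^sup>2) * (V - 3 * X\<^sup>2 / (2 * pi\<^sup>2))"
      unfolding g X_def using l by (simp add: field_simps power2_eq_square)
    then have "\<bar>farey_g2 l - 1\<bar> = 6 / (pi\<^sup>2 * l\<^sup>2) * \<bar>V - 3 * X\<^sup>2 / (2 * pi\<^sup>2)\<bar>"
      by (simp only: abs_mult) (simp add: abs_mult)
    also have "\<dots> \<le> 6 / (pi\<^sup>2 * l\<^sup>2) * (5 * X)"
      unfolding V_def by (intro mult_left_mono sum_totient_ln_approx X) auto
    also have "\<dots> = 10 * \<bar>1 / l\<bar>" using l by (simp add: X_def field_simps power2_eq_square)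
    finally show ?thesis by simp
  qed
  then show "\<forall>\<^sub>F l in at_top. norm (farey_g2 l - 1) \<le> 10 * norm (1 / l)"
    by (intro eventually_mono[OF eventually_ge_at_top[of 1]]) simp
qed

section \<open>Lattice points and primitive lattice points in convex regions\<close>

lemma lattice_cell_measure:
  fixes T :: real and m n :: int
  assumes "T > 0"
  shows "emeasure lborel {z :: real \<times> real. \<lfloor>T * fst z\<rfloor> = m \<and> \<lfloor>T * snd z\<rfloor> = n} = ennreal (1 / T\<^sup>2)"
    and "{z :: real \<times> real. \<lfloor>T * fst z\<rfloor> = m \<and> \<lfloor>T * snd z\<rfloor> = n} \<in> sets borel"
proof -
  have *: "{x. \<lfloor>T * x\<rfloor> = k} = {real_of_int k / T..<(real_of_int k + 1) / T}" for k
    using assms by (auto simp: floor_eq_iff field_simps)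
  have **: "{z :: real \<times> real. \<lfloor>T * fst z\<rfloor> = m \<and> \<lfloor>T * snd z\<rfloor> = n} = {x. \<lfloor>T * x\<rfloor> = m} \<times> {x. \<lfloor>T * x\<rfloor> = n}"
    by auto
  show "{z :: real \<times> real. \<lfloor>T * fst z\<rfloor> = m \<and> \<lfloor>T * snd z\<rfloor> = n} \<in> sets borel"
    unfolding ** * by (intro borel_Times) auto
  have "emeasure lborel {z :: real \<times> real. \<lfloor>T * fst z\<rfloor> = m \<and> \<lfloor>T * snd z\<rfloor> = n} =
        emeasure (lborel \<Otimes>\<^sub>M lborel) ({x. \<lfloor>T * x\<rfloor> = m} \<times> {x. \<lfloor>T * x\<rfloor> = n})"
    unfolding ** lborel_prod ..
  also have "\<dots> = emeasure lborel {x. \<lfloor>T * x\<rfloor> = m} * emeasure lborel {x. \<lfloor>T * x\<rfloor> = n}"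
    unfolding * by (intro lborel.emeasure_pair_measure_Times) auto
  also have "\<dots> = ennreal (1 / T) * ennreal (1 / T)"
    unfolding * using assms by (simp add: divide_right_mono add_divide_distrib)
  also have "\<dots> = ennreal (1 / T\<^sup>2)"
    using assms by (simp flip: ennreal_mult' add: power2_eq_square)
  finally show "emeasure lborel {z :: real \<times> real. \<lfloor>T * fst z\<rfloor> = m \<and> \<lfloor>T * snd z\<rfloor> = n} = ennreal (1 / T\<^sup>2)" .
qed

definition lattice_points :: "(real \<times> real) set \<Rightarrow> real \<Rightarrow> (int \<times> int) set" where
  "lattice_points \<Omega> T = {(m, n). (real_of_int m / T, real_of_int n / T) \<in> \<Omega>}"

lemma lattice_points_subset_box:
  assumes "\<Omega> \<subseteq> cball 0 R" "T > 0"
  shows "lattice_points \<Omega> T \<subseteq> {- \<lfloor>R * T\<rfloor>..\<lfloor>R * T\<rfloor>} \<times> {- \<lfloor>R * T\<rfloor>..\<lfloor>R * T\<rfloor>}"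
proof (clarsimp simp: lattice_points_def)
  fix m n assume "(real_of_int m / T, real_of_int n / T) \<in> \<Omega>"
  then have "norm (real_of_int m / T, real_of_int n / T) \<le> R" using assms by auto
  then have "\<bar>real_of_int m / T\<bar> \<le> R" "\<bar>real_of_int n / T\<bar> \<le> R"
    using norm_fst_le[of "real_of_int m / T" "real_of_int n / T"]
      norm_snd_le[of "real_of_int n / T" "real_of_int m / T"]
    by (simp_all only: real_norm_def)
  then have "\<bar>real_of_int m\<bar> \<le> R * T" "\<bar>real_of_int n\<bar> \<le> R * T"
    using assms by (auto simp: field_simps)
  then show "- \<lfloor>R * T\<rfloor> \<le> m \<and> m \<le> \<lfloor>R * T\<rfloor> \<and> - \<lfloor>R * T\<rfloor> \<le> n \<and> n \<le> \<lfloor>R * T\<rfloor>"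
    by (simp add: le_floor_iff abs_le_iff minus_le_iff)
qed

lemma finite_lattice_points:
  assumes "bounded \<Omega>" "T > 0"
  shows "finite (lattice_points \<Omega> T)"
proof -
  obtain R where "\<Omega> \<subseteq> cball 0 R" using bounded_subset_ballD[OF assms(1), of 0] ball_subset_cball by (meson order_trans)
  from finite_subset[OF lattice_points_subset_box[OF this assms(2)]] show ?thesis by simp
qed

text \<open>The bound holds for every \<open>T\<close>, however small: when \<open>T\<close> is so small that the box around
\<open>T \<Omega>\<close> contains only the origin, there is no point at all. This uniformity is what
\<open>tendsto_moebius_average\<close> asks for.\<close>
lemma card_lattice_points_bound:
  assumes "\<Omega> \<subseteq> cball 0 R" "T > 0" "R > 0" "(0, 0) \<notin> \<Omega>"
  shows "real (card (lattice_points \<Omega> T)) \<le> 9 * R\<^sup>2 * T\<^sup>2"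
proof (cases "R * T < 1")
  case True
  then have "\<lfloor>R * T\<rfloor> = 0" using assms by (simp add: floor_eq_iff)
  then have "lattice_points \<Omega> T \<subseteq> {(0, 0)}"
    using lattice_points_subset_box[OF assms(1,2)] by auto
  moreover have "(0, 0) \<notin> lattice_points \<Omega> T" using assms by (auto simp: lattice_points_def)
  ultimately have "lattice_points \<Omega> T = {}" by auto
  then show ?thesis by simp
next
  case False
  let ?k = "\<lfloor>R * T\<rfloor>"
  have k: "?k \<ge> 1" using False by simp
  have "card (lattice_points \<Omega> T) \<le> card ({- ?k..?k} \<times> {- ?k..?k})"
    by (intro card_mono lattice_points_subset_box assms) auto
  also have "real \<dots> = (2 * real_of_int ?k + 1)\<^sup>2"
    using k by (simp add: card_cartesian_product power2_eq_square of_nat_nat)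
  also have "\<dots> \<le> (3 * (R * T))\<^sup>2"
  proof (intro power_mono)
    have "real_of_int ?k \<ge> 1" using k by linarith
    then show "2 * real_of_int ?k + 1 \<le> 3 * (R * T)" using of_int_floor_le[of "R * T"] by linarith
  qed (use k in auto)
  finally show ?thesis by (simp add: power_mult_distrib)
qed

text \<open>The normalised count is the integral of the indicator of \<open>\<Omega>\<close> evaluated at the lower left corner
of the cell of the grid of width \<open>1 / T\<close> that contains the argument. These step functions converge to the
indicator of \<open>\<Omega>\<close> off the frontier, which is negligible for a convex set, so dominated convergence
applies.\<close>
lemma lattice_point_count:
  assumes "convex \<Omega>" "bounded \<Omega>"
  shows "((\<lambda>T. real (card (lattice_points \<Omega> T)) / T\<^sup>2) \<longlongrightarrow> measure lebesgue \<Omega>) at_top"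
proof -
  obtain R where R: "\<Omega> \<subseteq> cball 0 R" using bounded_subset_ballD[OF assms(2), of 0] ball_subset_cball by (meson order_trans)
  define r :: "real \<Rightarrow> real \<times> real \<Rightarrow> real \<times> real" where
    "r T z = (of_int \<lfloor>T * fst z\<rfloor> / T, of_int \<lfloor>T * snd z\<rfloor> / T)" for T z
  define s :: "real \<Rightarrow> real \<times> real \<Rightarrow> real" where
    "s T z = (if T > 0 then indicator \<Omega> (r T z) else 0)" for T z
  have s_eq: "s T = (\<lambda>z. \<Sum>(m, n)\<in>lattice_points \<Omega> T.
                 indicator {z. \<lfloor>T * fst z\<rfloor> = m \<and> \<lfloor>T * snd z\<rfloor> = n} z)" if T: "T > 0" for T
  proof
    fix z :: "real \<times> real"
    let ?p = "(\<lfloor>T * fst z\<rfloor>, \<lfloor>T * snd z\<rfloor>)"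
    have "(\<Sum>(m, n)\<in>lattice_points \<Omega> T. indicator {z. \<lfloor>T * fst z\<rfloor> = m \<and> \<lfloor>T * snd z\<rfloor> = n} z :: real)
          = (\<Sum>p\<in>lattice_points \<Omega> T. if p = ?p then 1 else 0)"
      by (rule sum.cong) (auto simp: indicator_def)
    also have "\<dots> = s T z"
      using T finite_lattice_points[OF assms(2) T] by (auto simp: s_def r_def lattice_points_def indicator_def)
    finally show "s T z = (\<Sum>(m, n)\<in>lattice_points \<Omega> T. indicator {z. \<lfloor>T * fst z\<rfloor> = m \<and> \<lfloor>T * snd z\<rfloor> = n} z)" ..
  qed
  have meas: "s T \<in> borel_measurable lborel" for T
  proof (cases "T > 0")
    case True
    have "(\<lambda>z. \<Sum>(m, n)\<in>lattice_points \<Omega> T. indicator {z. \<lfloor>T * fst z\<rfloor> = m \<and> \<lfloor>T * snd z\<rfloor> = n} z :: real)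
             \<in> borel_measurable lborel"
      unfolding case_prod_beta
      by (intro borel_measurable_sum borel_measurable_indicator) (use lattice_cell_measure(2)[OF True] in auto)
    then show ?thesis using s_eq[OF True] by simp
  next
    case False
    then have "s T = (\<lambda>_. 0)" by (auto simp: s_def)
    then show ?thesis by simp
  qed
  have int: "integral\<^sup>L lborel (s T) = real (card (lattice_points \<Omega> T)) / T\<^sup>2" if T: "T > 0" for T
  proof -
    have "integral\<^sup>L lborel (s T) = (\<Sum>p\<in>lattice_points \<Omega> T.
            integral\<^sup>L lborel (indicator {z. \<lfloor>T * fst z\<rfloor> = fst p \<and> \<lfloor>T * snd z\<rfloor> = snd p}))"
      unfolding s_eq[OF T] case_prod_beta
      by (intro Bochner_Integration.integral_sum)
         (use lattice_cell_measure[OF T] in \<open>auto simp: integrable_indicator_iff\<close>)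
    also have "\<dots> = (\<Sum>p\<in>lattice_points \<Omega> T. 1 / T\<^sup>2)"
      using lattice_cell_measure(1)[OF T] by (simp add: measure_def)
    finally show ?thesis by simp
  qed
  have lim: "((\<lambda>T. integral\<^sup>L lebesgue (s T)) \<longlongrightarrow> integral\<^sup>L lebesgue (indicator \<Omega> :: _ \<Rightarrow> real)) at_top"
  proof (rule integral_dominated_convergence_at_top)
    show "(indicator \<Omega> :: _ \<Rightarrow> real) \<in> borel_measurable lebesgue"
      using measurable_convex[OF assms] by (intro borel_measurable_indicator) (rule fmeasurableD)
    show "s T \<in> borel_measurable lebesgue" for T
      using meas[of T] by (rule measurable_completion)
    show "integrable lebesgue (indicator (cball 0 (R + 2) :: (real \<times> real) set) :: _ \<Rightarrow> real)"
      using lmeasurable_cball[of "0 :: real \<times> real" "R + 2"] 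
      by (simp add: integrable_indicator_iff fmeasurable_def)
    have dist_r: "dist (r T z) z \<le> 2 / T" if T: "T > 0" for T z
    proof -
      have *: "dist (of_int \<lfloor>T * x\<rfloor> / T) x \<le> 1 / T" for x
      proof -
        have "\<bar>of_int \<lfloor>T * x\<rfloor> - T * x\<bar> \<le> 1" by linarith
        moreover have "of_int \<lfloor>T * x\<rfloor> / T - x = (of_int \<lfloor>T * x\<rfloor> - T * x) / T" using T by (simp add: field_simps)
        ultimately show ?thesis using T by (simp add: dist_real_def divide_right_mono)
      qed
      have "dist (r T z) z \<le> dist (of_int \<lfloor>T * fst z\<rfloor> / T) (fst z) + dist (of_int \<lfloor>T * snd z\<rfloor> / T) (snd z)"
        unfolding r_def dist_prod_def by (simp add: sqrt_sum_squares_le_sum)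
      also have "\<dots> \<le> 1 / T + 1 / T" by (intro add_mono *)
      finally show ?thesis by simp
    qed
    show "\<forall>\<^sub>F T in at_top. AE z in lebesgue. norm (s T z) \<le> indicator (cball 0 (R + 2)) z"
      using eventually_ge_at_top[of 1]
    proof eventually_elim
      case (elim T)
      have "z \<in> cball 0 (R + 2)" if "r T z \<in> \<Omega>" for z
      proof -
        have "dist z 0 \<le> dist (r T z) z + dist (r T z) 0" by (rule dist_triangle2[of z 0 "r T z", simplified dist_commute[of z "r T z"] dist_commute[of 0 "r T z"]])
        also have "\<dots> \<le> 2 / T + R" using dist_r[of T z] elim R that by (intro add_mono) (auto simp: dist_norm)
        also have "2 / T \<le> 2" using elim by (simp add: field_simps)
        finally show ?thesis by (simp add: dist_norm)
      qed
      then have "norm (s T z) \<le> indicator (cball 0 (R + 2)) z" for z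
        by (auto simp: s_def indicator_def)
      then show ?case by simp
    qed
    have "AE z in lebesgue. z \<notin> frontier \<Omega>"
      using negligible_convex_frontier[OF assms(1)] 
      by (intro AE_not_in) (simp add: negligible_iff_null_sets)
    then show "AE z in lebesgue. ((\<lambda>T. s T z) \<longlongrightarrow> indicator \<Omega> z) at_top"
    proof eventually_elim
      case (elim z)
      have r: "((\<lambda>T. r T z) \<longlongrightarrow> z) at_top"
      proof (rule metric_tendsto_imp_tendsto)
        have "((\<lambda>T::real. 2 / T) \<longlongrightarrow> 0) at_top"
          by (intro tendsto_divide_0[OF tendsto_const] filterlim_at_top_imp_at_infinity filterlim_ident)
        then show "((\<lambda>T::real. 2 / T) \<longlongrightarrow> 0) at_top" .
        show "\<forall>\<^sub>F T in at_top. dist (r T z) z \<le> dist (2 / T) 0"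
          using eventually_gt_at_top[of 0] by eventually_elim (use dist_r in auto)
      qed
      from elim have "z \<in> interior \<Omega> \<or> z \<in> - closure \<Omega>" by (auto simp: frontier_def)
      then have "\<forall>\<^sub>F T in at_top. s T z = indicator \<Omega> z"
      proof
        assume z: "z \<in> interior \<Omega>"
        with topological_tendstoD[OF r open_interior] have "\<forall>\<^sub>F T in at_top. r T z \<in> interior \<Omega>" by blast
        then show ?thesis using eventually_gt_at_top[of 0]
          by eventually_elim (use z interior_subset in \<open>auto simp: s_def indicator_def\<close>)
      next
        assume z: "z \<in> - closure \<Omega>"
        with topological_tendstoD[OF r, of "- closure \<Omega>"] have "\<forall>\<^sub>F T in at_top. r T z \<in> - closure \<Omega>" by blast
        then show ?thesis using eventually_gt_at_top[of 0]
          by eventually_elim (use z closure_subset in \<open>auto simp: s_def indicator_def\<close>)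
      qed
      then show ?case by (rule tendsto_eventually)
    qed
  qed
  have "integral\<^sup>L lebesgue (indicator \<Omega> :: _ \<Rightarrow> real) = measure lebesgue \<Omega>" by simp
  note lim = lim[unfolded this]
  have "\<forall>\<^sub>F T in at_top. integral\<^sup>L lebesgue (s T) = real (card (lattice_points \<Omega> T)) / T\<^sup>2"
    using eventually_gt_at_top[of 0] by eventually_elim (use int integral_completion[OF meas] in auto)
  then show ?thesis by (rule Lim_transform_eventually[OF lim])
qed

text \<open>A pair of integers other than the origin is sieved by the divisors \<open>d\<close> of its gcd, and the points divisible by
\<open>d\<close> are the points of the lattice dilated by \<open>d\<close>, so that the count is the Moebius average of the
full counts at the scales \<open>T / d\<close>.\<close>
lemma primitive_lattice_point_count:
  assumes "convex \<Omega>" "bounded \<Omega>" "(0, 0) \<notin> \<Omega>"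
  shows "((\<lambda>T. real (card {(m, n)\<in>lattice_points \<Omega> T. coprime m n}) / T\<^sup>2)
            \<longlongrightarrow> 6 / pi\<^sup>2 * measure lebesgue \<Omega>) at_top"
proof -
  obtain R where R: "\<Omega> \<subseteq> cball 0 R" "R > 0" using bounded_subset_ballD[OF assms(2), of 0] ball_subset_cball by (meson order_trans)
  define a where "a T = (if T > 0 then real (card (lattice_points \<Omega> T)) / T\<^sup>2 else 0)" for T
  have "((\<lambda>T. a T) \<longlongrightarrow> measure lebesgue \<Omega>) at_top"
    using eventually_gt_at_top[of 0]
    by (rule Lim_transform_eventually[OF lattice_point_count[OF assms(1,2)] eventually_mono]) (auto simp: a_def)
  moreover have bound: "\<bar>a T\<bar> \<le> 9 * R\<^sup>2" for T
    using card_lattice_points_bound[OF R(1) _ R(2) assms(3), of T] by (auto simp: a_def field_simps)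
  ultimately have "((\<lambda>T. \<Sum>d. moebius_mu (Suc d) / real (Suc d) ^ 2 * a (T / real (Suc d)))
           \<longlongrightarrow> 6 / pi\<^sup>2 * measure lebesgue \<Omega>) at_top"
    using tendsto_moebius_average(1)[of a "measure lebesgue \<Omega>" "9 * R\<^sup>2"] 
    unfolding suminf_moebius_over_square by blast
  moreover have "\<forall>\<^sub>F T in at_top. (\<Sum>d. moebius_mu (Suc d) / real (Suc d) ^ 2 * a (T / real (Suc d))) =
      real (card {(m, n)\<in>lattice_points \<Omega> T. coprime m n}) / T\<^sup>2"
    using eventually_gt_at_top[of 0]
  proof eventually_elim
    case (elim T)
    let ?L = "lattice_points \<Omega> T"
    note fin = finite_lattice_points[OF assms(2) elim]
    define D where "D = nat \<lfloor>R * T\<rfloor>"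
    have g: "gcd m n \<noteq> 0" "gcd m n \<le> int D" if "(m, n) \<in> ?L" for m n
    proof -
      have box: "\<bar>m\<bar> \<le> int D" "\<bar>n\<bar> \<le> int D"
        using subsetD[OF lattice_points_subset_box[OF R(1) elim] that] R(2) elim by (auto simp: D_def)
      have mn: "m \<noteq> 0 \<or> n \<noteq> 0" using that assms(3) by (auto simp: lattice_points_def)
      then show "gcd m n \<noteq> 0" by simp
      have "gcd m n \<le> \<bar>m\<bar> \<or> gcd m n \<le> \<bar>n\<bar>" using mn
        by (metis gcd_dvd1 gcd_dvd2 dvd_imp_le_int abs_of_nonneg gcd_ge_0_int)
      then show "gcd m n \<le> int D" using box by linarith
    qed
    have scale: "card {z\<in>?L. int d dvd fst z \<and> int d dvd snd z} = card (lattice_points \<Omega> (T / real d))"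
      if "d > 0" for d
    proof (rule bij_betw_same_card[symmetric])
      show "bij_betw (\<lambda>(m, n). (int d * m, int d * n)) (lattice_points \<Omega> (T / real d)) {z\<in>?L. int d dvd fst z \<and> int d dvd snd z}"
        by (rule bij_betw_byWitness[where f' = "\<lambda>(m, n). (m div int d, n div int d)"])
           (use that elim in \<open>auto simp: lattice_points_def mult.commute elim!: dvdE\<close>)
    qed
    have small: "a (T / real (Suc d)) = 0" if "d \<ge> D" for d
    proof -
      have "R * T < real (Suc d)" using that unfolding D_def by linarith
      then have "\<lfloor>R * (T / real (Suc d))\<rfloor> = 0"
        using elim R(2) by (simp add: floor_eq_iff del: of_nat_Suc)
      then have "lattice_points \<Omega> (T / real (Suc d)) \<subseteq> {(0, 0)}"
        using lattice_points_subset_box[OF R(1), of "T / real (Suc d)"] elim by auto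
      then have "lattice_points \<Omega> (T / real (Suc d)) = {}"
        using assms(3) by (auto simp: lattice_points_def)
      then show ?thesis by (simp add: a_def)
    qed
    have "{(m, n)\<in>?L. coprime m n} = {z\<in>?L. coprime (fst z) (snd z)}" by auto
    then have "real (card {(m, n)\<in>?L. coprime m n}) = (\<Sum>(m, n)\<in>?L. if coprime m n then 1 else 0)"
      using fin by (simp add: case_prod_beta flip: sum.inter_filter)
    also have "\<dots> = (\<Sum>(m, n)\<in>?L. \<Sum>d\<in>{1..D}. if int d dvd m \<and> int d dvd n then moebius_mu d else 0)"
      using g by (intro sum.cong refl) (auto simp: indicator_coprime_eq_sum_moebius[of _ _ D] simp flip: sum.inter_filter)
    also have "\<dots> = (\<Sum>d\<in>{1..D}. \<Sum>(m, n)\<in>?L. if int d dvd m \<and> int d dvd n then moebius_mu d else 0)"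
      unfolding case_prod_beta by (rule sum.swap)
    also have "\<dots> = (\<Sum>d\<in>{1..D}. moebius_mu d * real (card (lattice_points \<Omega> (T / real d))))"
      using fin by (intro sum.cong refl) (auto simp: case_prod_beta simp flip: sum.inter_filter scale)
    also have "\<dots> = T\<^sup>2 * (\<Sum>d\<in>{1..D}. moebius_mu d / real d ^ 2 * a (T / real d))"
      using elim unfolding sum_distrib_left
      by (intro sum.cong refl) (auto simp: a_def field_simps)
    also have "(\<Sum>d\<in>{1..D}. moebius_mu d / real d ^ 2 * a (T / real d)) =
               (\<Sum>d<D. moebius_mu (Suc d) / real (Suc d) ^ 2 * a (T / real (Suc d)))"
      by (rule sum.atLeast1_atMost_eq[of _ D, folded One_nat_def])
    also have "\<dots> = (\<Sum>d. moebius_mu (Suc d) / real (Suc d) ^ 2 * a (T / real (Suc d)))"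
      by (rule suminf_finite[symmetric]) (use small in \<open>auto simp del: of_nat_Suc\<close>)
    finally show ?case using elim by simp
  qed
  ultimately show ?thesis by (rule Lim_transform_eventually)
qed

section \<open>Farey fractions and their pairs as lattice points\<close>

lemma farey_iff: "x \<in> farey Q \<longleftrightarrow>
   (\<exists>a q :: int. 1 \<le> a \<and> a \<le> q \<and> q \<le> int Q \<and> coprime a q \<and> x = real_of_int a / real_of_int q)"
proof
  assume "x \<in> farey Q"
  then obtain a q where "x = real a / real q" "1 \<le> a" "a \<le> q" "q \<le> Q" "coprime a q"
    by (auto simp: farey_def)
  then show "\<exists>a q :: int. 1 \<le> a \<and> a \<le> q \<and> q \<le> int Q \<and> coprime a q \<and> x = real_of_int a / real_of_int q"
    by (intro exI[of _ "int a"] exI[of _ "int q"]) simp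
next
  assume "\<exists>a q :: int. 1 \<le> a \<and> a \<le> q \<and> q \<le> int Q \<and> coprime a q \<and> x = real_of_int a / real_of_int q"
  then obtain a q :: int where "1 \<le> a" "a \<le> q" "q \<le> int Q" "coprime a q" "x = real_of_int a / real_of_int q"
    by blast
  moreover from this have "coprime (nat a) (nat q)" using coprime_int_iff[of "nat a" "nat q"] by simp
  ultimately show "x \<in> farey Q"
    unfolding farey_def
    by (intro CollectI exI[of _ "nat a"] exI[of _ "nat q"]) (simp add: nat_le_iff)
qed

lemma int_dvd_abs_less_imp_eq_0:
  fixes d i :: int
  assumes "d dvd i" "\<bar>i\<bar> < d"
  shows "i = 0"
proof (rule ccontr)
  assume "i \<noteq> 0"
  then show False using dvd_imp_le_int[OF _ assms(1)] assms(2) by linarith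
qed

lemma reduced_fraction_unique:
  fixes a q c d :: int
  assumes "real_of_int a / real_of_int q = real_of_int c / real_of_int d"
    and "coprime a q" "coprime c d" "q > 0" "d > 0"
  shows "a = c \<and> q = d"
proof -
  have "real_of_int (a * d) = real_of_int (c * q)" using assms by (simp add: field_simps)
  then have eq: "a * d = c * q" by (simp only: of_int_eq_iff)
  then have "\<bar>a\<bar> = \<bar>c\<bar> \<and> \<bar>d\<bar> = \<bar>q\<bar>"
    using coprime_crossproduct_int[of a q c d] assms by (metis abs_mult)
  then have "d = q" using assms by simp
  then show ?thesis using eq assms by simp
qed

lemma bij_betw_farey:
  "bij_betw (\<lambda>(q, a). real_of_int a / real_of_int q)
     {(q, a). 1 \<le> a \<and> a \<le> q \<and> q \<le> int Q \<and> coprime q a} (farey Q)"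
proof (rule bij_betw_imageI)
  show "inj_on (\<lambda>(q, a). real_of_int a / real_of_int q) {(q, a). 1 \<le> a \<and> a \<le> q \<and> q \<le> int Q \<and> coprime q a}"
    by (auto simp: inj_on_def coprime_commute dest!: reduced_fraction_unique)
  show "(\<lambda>(q, a). real_of_int a / real_of_int q) ` {(q, a). 1 \<le> a \<and> a \<le> q \<and> q \<le> int Q \<and> coprime q a} = farey Q"
    unfolding set_eq_iff image_iff farey_iff by (auto simp: Bex_def) (metis coprime_commute)+
qed

lemma finite_farey: "finite (farey Q)"
proof -
  have "finite {(q, a). 1 \<le> a \<and> a \<le> q \<and> q \<le> int Q \<and> coprime q a}"
    by (rule finite_subset[of _ "{1..int Q} \<times> {1..int Q}"]) auto
  then show ?thesis using bij_betw_finite[OF bij_betw_farey] by blast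
qed

lemma farey_subset: "farey Q \<subseteq> {0<..1}"
  by (auto simp: farey_iff)

lemma incseq_farey: "incseq farey"
  by (fastforce simp: incseq_def farey_def)

text \<open>Pairs of fractions \<open>a / q\<close> and \<open>a' / q'\<close> as pairs of primitive vectors with positive determinant.
The second fraction is a lift to the real line of a point of the circle, hence \<open>a'\<close> is not bounded by
\<open>q'\<close>. The distance of the fractions is the determinant divided by \<open>q q'\<close>.\<close>
definition vector_pairs :: "nat \<Rightarrow> real \<Rightarrow> real \<Rightarrow> ((int \<times> int) \<times> (int \<times> int)) set" where
  "vector_pairs Q N t = {((q, a), (q', a')). 1 \<le> a \<and> a \<le> q \<and> q \<le> int Q \<and> coprime q a \<and>
      1 \<le> q' \<and> q' \<le> int Q \<and> coprime q' a' \<and> 0 < a' * q - a * q' \<and>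
      N * real_of_int (a' * q - a * q') \<le> t * real_of_int (q * q')}"

text \<open>A pair \<open>(x, y)\<close> corresponds to \<open>y\<close> together with the lift of \<open>x\<close> modulo one that lies in the
interval of length one to the right of \<open>y\<close>; as \<open>y\<close> is at most one, this lift is \<open>x\<close> or \<open>x + 1\<close>. The
distance from \<open>y\<close> to the lift is \<open>frac (x - y)\<close>, and \<open>t < N\<close> makes it less than one.\<close>
lemma card_farey_pairs_eq_vector_pairs:
  assumes N: "N > 0" and t: "t < N"
  shows "card {(x, y). x \<in> farey Q \<and> y \<in> farey Q \<and> x \<noteq> y \<and> N * frac (x - y) \<le> t} =
         card (vector_pairs Q N t)"
proof (rule bij_betw_same_card[symmetric])
  define h :: "(int \<times> int) \<times> (int \<times> int) \<Rightarrow> real \<times> real" where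
    "h = (\<lambda>((q, a), (q', a')). (if a' \<le> q' then real_of_int a' / real_of_int q'
             else real_of_int a' / real_of_int q' - 1, real_of_int a / real_of_int q))"
  let ?S = "{(x, y). x \<in> farey Q \<and> y \<in> farey Q \<and> x \<noteq> y \<and> N * frac (x - y) \<le> t}"
  have gap: "0 < real_of_int a' / real_of_int q' - real_of_int a / real_of_int q"
      "N * (real_of_int a' / real_of_int q' - real_of_int a / real_of_int q) \<le> t"
      "real_of_int a' / real_of_int q' - real_of_int a / real_of_int q < 1"
    if "((q, a), (q', a')) \<in> vector_pairs Q N t" for q a q' a'
  proof -
    have pos: "q > 0" "q' > 0" using that by (auto simp: vector_pairs_def)
    then have eq: "real_of_int a' / real_of_int q' - real_of_int a / real_of_int q =
          real_of_int (a' * q - a * q') / real_of_int (q * q')"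
      by (simp add: field_simps)
    show "0 < real_of_int a' / real_of_int q' - real_of_int a / real_of_int q"
      unfolding eq using pos that by (intro divide_pos_pos) (auto simp: vector_pairs_def simp flip: of_int_mult)
    show *: "N * (real_of_int a' / real_of_int q' - real_of_int a / real_of_int q) \<le> t"
      unfolding eq using pos that 
      by (simp add: vector_pairs_def field_simps flip: of_int_mult)
    then have "N * (real_of_int a' / real_of_int q' - real_of_int a / real_of_int q) < N * 1" using t by simp
    then show "real_of_int a' / real_of_int q' - real_of_int a / real_of_int q < 1"
      using N by (simp only: mult_less_cancel_left_pos)
  qed
  have frac_eq: "frac (z - y) = z - y" "frac (z - 1 - y) = z - y" if "0 < z - y" "z - y < 1" for z y :: real
  proof -
    show "frac (z - y) = z - y" using that by (simp add: frac_eq)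
    show "frac (z - 1 - y) = z - y"
      unfolding frac_unique_iff using that by simp
  qed
  show "bij_betw h (vector_pairs Q N t) ?S"
  proof (rule bij_betw_imageI)
    show "inj_on h (vector_pairs Q N t)"
    proof (rule inj_onI)
      fix u v assume uv: "u \<in> vector_pairs Q N t" "v \<in> vector_pairs Q N t" "h u = h v"
      obtain q a q' a' where u: "u = ((q, a), (q', a'))" by (metis surj_pair)
      obtain d c d' c' where v: "v = ((d, c), (d', c'))" by (metis surj_pair)
      note 1 = uv(1)[unfolded u] and 2 = uv(2)[unfolded v] and h = uv(3)[unfolded u v]
      let ?z = "real_of_int a' / real_of_int q'" and ?w = "real_of_int c' / real_of_int d'"
      have y: "real_of_int a / real_of_int q = real_of_int c / real_of_int d" using h by (simp add: h_def)
      then have first: "a = c" "q = d"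
        using reduced_fraction_unique[of a q c d] 1 2 by (auto simp: vector_pairs_def coprime_commute)
      \<comment> \<open>Both lifts lie in an interval of length one to the right of the first fraction.\<close>
      have "?z - ?w < 1" "?w - ?z < 1" using gap[OF 1] gap[OF 2] y by linarith+
      moreover have "?z = ?w \<or> ?z = ?w - 1 \<or> ?z - 1 = ?w"
        using h by (auto simp: h_def split: if_splits)
      ultimately have "?z = ?w" by linarith
      then have "a' = c' \<and> q' = d'"
        using reduced_fraction_unique[of a' q' c' d'] 1 2 by (auto simp: vector_pairs_def coprime_commute)
      with first show "u = v" by (simp add: u v)
    qed
    show "h ` vector_pairs Q N t = ?S"
    proof (intro equalityI subsetI)
      fix p assume "p \<in> h ` vector_pairs Q N t"
      then obtain q a q' a' where v: "((q, a), (q', a')) \<in> vector_pairs Q N t" and p: "p = h ((q, a), (q', a'))"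
        by auto
      let ?z = "real_of_int a' / real_of_int q'" and ?y = "real_of_int a / real_of_int q"
      note g = gap[OF v]
      have v': "1 \<le> a" "a \<le> q" "q \<le> int Q" "coprime q a" "1 \<le> q'" "q' \<le> int Q" "coprime q' a'"
        using v by (auto simp: vector_pairs_def)
      have y: "?y \<in> farey Q" "0 < ?y" "?y \<le> 1" using v' by (auto simp: farey_iff coprime_commute)
      have z: "0 < ?z" "?z < 2" using g y by linarith+
      have a': "0 < a'" "a' < 2 * q'" using z v' by (auto simp: zero_less_divide_iff divide_less_eq)
      show "p \<in> ?S"
      proof (cases "a' \<le> q'")
        case True
        then have "?z \<in> farey Q" unfolding farey_iff
          using a' v' by (intro exI[of _ a'] exI[of _ q']) (auto simp: coprime_commute)
        then show ?thesis using y g True by (auto simp: p h_def frac_eq)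
      next
        case False
        have z1: "?z - 1 = real_of_int (a' - q') / real_of_int q'" using v' by (simp add: field_simps)
        have "coprime (a' - q') q'" using v' 
          by (metis coprime_commute coprime_iff_gcd_eq_1 gcd_diff1)
        then have "?z - 1 \<in> farey Q" unfolding z1 farey_iff
          using a' v' False by (intro exI[of _ "a' - q'"] exI[of _ q']) auto
        then show ?thesis using y g False by (auto simp: p h_def frac_eq)
      qed
    next
      fix p assume "p \<in> ?S"
      then obtain x y where p: "p = (x, y)" "x \<in> farey Q" "y \<in> farey Q" "x \<noteq> y" "N * frac (x - y) \<le> t" by auto
      from p(2) obtain c q' where x: "1 \<le> c" "c \<le> q'" "q' \<le> int Q" "coprime c q'" "x = real_of_int c / real_of_int q'"
        by (auto simp: farey_iff)
      from p(3) obtain a q where y: "1 \<le> a" "a \<le> q" "q \<le> int Q" "coprime a q" "y = real_of_int a / real_of_int q"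
        by (auto simp: farey_iff)
      have xy: "0 < x" "x \<le> 1" "0 < y" "y \<le> 1" using subsetD[OF farey_subset p(2)] subsetD[OF farey_subset p(3)] by auto
      define a' where "a' = (if y < x then c else c + q')"
      let ?z = "real_of_int a' / real_of_int q'"
      have z: "?z = (if y < x then x else x + 1)" using x by (auto simp: a'_def field_simps)
      have zy: "0 < ?z - y" "?z - y < 1" using xy p(4) unfolding z by auto
      have fr: "frac (x - y) = ?z - y" using frac_eq[OF zy] unfolding z by (auto split: if_splits)
      have det: "?z - y = real_of_int (a' * q - a * q') / real_of_int (q * q')"
        unfolding y(5) using x y by (simp add: field_simps)
      have qq: "real_of_int (q * q') > 0" using x y by simp
      have "real_of_int (a' * q - a * q') > 0"
        using zy(1) qq unfolding det by (simp add: zero_less_divide_iff del: of_int_mult of_int_diff)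
      moreover have "N * real_of_int (a' * q - a * q') \<le> t * real_of_int (q * q')"
        using p(5) qq unfolding fr det by (simp add: field_simps del: of_int_mult of_int_diff)
      moreover have "coprime a' q'"
      proof -
        have "coprime (c + q') q'" using x(4) by (metis coprime_iff_gcd_eq_1 gcd_add1)
        with x(4) show ?thesis by (simp add: a'_def)
      qed
      then have cop: "coprime q' a'" by (rule coprime_commute[THEN iffD1])
      moreover note cop
      ultimately have "((q, a), (q', a')) \<in> vector_pairs Q N t"
        using x y coprime_commute[of a q] by (simp add: vector_pairs_def del: of_int_mult of_int_diff)
      moreover have "h ((q, a), (q', a')) = p"
        using z x unfolding h_def p(1) by (auto simp: a'_def y)
      ultimately show "p \<in> h ` vector_pairs Q N t" by force
    qed
  qed
qed

text \<open>Here \<open>v = (q, a)\<close> and \<open>u = (p, b)\<close> form a basis of the integer lattice of determinant one; the second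
vector of the pair is \<open>j v + k u\<close>, so that \<open>k\<close> is the determinant of the pair.\<close>
definition based_pairs :: "nat \<Rightarrow> real \<Rightarrow> real \<Rightarrow> nat \<Rightarrow> (nat \<times> nat \<times> (int \<times> int) \<times> (int \<times> int)) set" where
  "based_pairs Q N t K = {(k, j, (q, a), (p, b)). k \<in> {1..K} \<and> j \<in> totatives k \<and>
      1 \<le> a \<and> a \<le> q \<and> q \<le> int Q \<and> b * q - a * p = 1 \<and>
      1 \<le> int j * q + int k * p \<and> int j * q + int k * p \<le> int Q \<and>
      N * real k \<le> t * real_of_int (q * (int j * q + int k * p))}"

lemma coprime_if_int_combination:
  fixes a b x y :: int
  assumes "a * x + b * y = 1"
  shows "coprime a b"
  by (rule coprimeI) (metis assms dvd_add dvd_mult2)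

lemma ex_representative_between:
  fixes x k :: int
  assumes "k > 0"
  obtains m where "1 \<le> x + m * k" "x + m * k \<le> k"
proof
  have *: "x + - ((x - 1) div k) * k = (x - 1) mod k + 1"
    by (simp add: minus_div_mult_eq_mod [symmetric])
  show "1 \<le> x + - ((x - 1) div k) * k" "x + - ((x - 1) div k) * k \<le> k"
    unfolding * using assms by (simp_all add: add1_zle_eq)
qed

text \<open>The vectors that complete a primitive \<open>v\<close> to a basis of determinant one differ by multiples of \<open>v\<close>. A vector
\<open>w\<close> with determinant \<open>k\<close> against \<open>v\<close> thus equals \<open>j v + k u\<close> for exactly one such
\<open>u\<close> and one \<open>j\<close> between \<open>1\<close> and \<open>k\<close>, and \<open>w\<close> is primitive exactly when \<open>j\<close> is prime to
\<open>k\<close>. The distance condition forces \<open>k N \<le> t q q' \<le> t Q\<^sup>2\<close>, hence \<open>k \<le> K\<close>: only boundedly many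
determinants occur.\<close>
lemma card_vector_pairs_eq_based_pairs:
  assumes N: "N > 0" and K: "t * real Q ^ 2 \<le> real K * N"
  shows "card (vector_pairs Q N t) = card (based_pairs Q N t K)"
proof (rule bij_betw_same_card[symmetric])
  define f :: "nat \<times> nat \<times> (int \<times> int) \<times> (int \<times> int) \<Rightarrow> (int \<times> int) \<times> (int \<times> int)" where
    "f = (\<lambda>(k, j, (q, a), (p, b)). ((q, a), (int j * q + int k * p, int j * a + int k * b)))"
  have det: "(j * a + k * b) * q - a * (j * q + k * p) = k" if "b * q - a * p = 1" for j k a b p q :: int
  proof -
    have "(j * a + k * b) * q - a * (j * q + k * p) = k * (b * q - a * p)" by (simp add: algebra_simps)
    then show ?thesis using that by simp
  qed
  show "bij_betw f (based_pairs Q N t K) (vector_pairs Q N t)"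
  proof (rule bij_betw_imageI)
    show "inj_on f (based_pairs Q N t K)"
    proof (rule inj_onI)
      fix u v assume uv: "u \<in> based_pairs Q N t K" "v \<in> based_pairs Q N t K" "f u = f v"
      obtain k j q a p b where u: "u = (k, j, (q, a), (p, b))" by (metis surj_pair)
      obtain k' j' q' a' p' b' where v: "v = (k', j', (q', a'), (p', b'))" by (metis surj_pair)
      note 1 = uv(1)[unfolded u] and 2 = uv(2)[unfolded v] and eq = uv(3)[unfolded u v]
      have [simp]: "q' = q" "a' = a" using eq by (auto simp: f_def)
      have uni: "b * q - a * p = 1" "b' * q - a * p' = 1" using 1 2 by (auto simp: based_pairs_def)
      have e: "int j * q + int k * p = int j' * q + int k' * p'" "int j * a + int k * b = int j' * a + int k' * b'"
        using eq by (auto simp: f_def)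
      have "int k = int k'" using det[OF uni(1), of "int j" "int k"] det[OF uni(2), of "int j'" "int k'"] e by simp
      then have [simp]: "k' = k" by simp
      have "int j - int j' = (int j - int j') * (b * q - a * p)" using uni by simp
      also have "\<dots> = b * (int j * q - int j' * q) - p * (int j * a - int j' * a)" by (simp add: algebra_simps)
      also have "int j * q - int j' * q = int k * (p' - p)" using e by (simp add: algebra_simps)
      also have "int j * a - int j' * a = int k * (b' - b)" using e by (simp add: algebra_simps)
      also have "b * (int k * (p' - p)) - p * (int k * (b' - b)) = int k * (b * (p' - p) - p * (b' - b))"
        by (simp add: algebra_simps)
      finally have "int k dvd int j - int j'" by simp
      moreover have "\<bar>int j - int j'\<bar> < int k" using 1 2 by (auto simp: based_pairs_def in_totatives_iff)
      ultimately have "int j - int j' = 0" by (rule int_dvd_abs_less_imp_eq_0)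
      then have [simp]: "j' = j" by simp
      have "k > 0" using 1 by (auto simp: based_pairs_def)
      then show "u = v" using e by (simp add: u v)
    qed
    show "f ` based_pairs Q N t K = vector_pairs Q N t"
    proof (intro equalityI subsetI)
      fix v assume "v \<in> f ` based_pairs Q N t K"
      then obtain k j q a p b where B: "(k, j, (q, a), (p, b)) \<in> based_pairs Q N t K"
        and v: "v = ((q, a), (int j * q + int k * p, int j * a + int k * b))"
        by (auto simp: f_def)
      have uni: "b * q - a * p = 1" using B by (auto simp: based_pairs_def)
      have jk: "coprime (int j) (int k)" "k > 0" using B by (auto simp: based_pairs_def in_totatives_iff)
      have "coprime q a" using coprime_if_int_combination[of q b a "-p"] uni by (simp add: algebra_simps)
      moreover have "coprime (int j * q + int k * p) (int j * a + int k * b)"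
      proof (rule coprimeI)
        fix c assume c: "c dvd int j * q + int k * p" "c dvd int j * a + int k * b"
        have "c dvd (int j * a + int k * b) * q - a * (int j * q + int k * p)"
          using c by (intro dvd_diff dvd_mult dvd_mult2)
        then have "c dvd int k" unfolding det[OF uni] .
        moreover have "c dvd b * (int j * q + int k * p) - p * (int j * a + int k * b)"
          using c by (intro dvd_diff dvd_mult)
        then have "c dvd int j * (b * q - a * p)" by (simp add: algebra_simps)
        then have "c dvd int j" using uni by simp
        ultimately show "is_unit c" using jk coprime_common_divisor by blast
      qed
      ultimately show "v \<in> vector_pairs Q N t"
        using B jk det[OF uni, of "int j" "int k"] unfolding v vector_pairs_def based_pairs_def
        by (simp del: of_int_mult of_int_diff)
    next
      fix v assume "v \<in> vector_pairs Q N t"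
      then obtain q a q' a' where v: "v = ((q, a), (q', a'))" and
        V: "1 \<le> a" "a \<le> q" "q \<le> int Q" "coprime q a" "1 \<le> q'" "q' \<le> int Q" "coprime q' a'"
           "0 < a' * q - a * q'" "N * real_of_int (a' * q - a * q') \<le> t * real_of_int (q * q')"
        by (auto simp: vector_pairs_def)
      define k where "k = nat (a' * q - a * q')"
      have k: "int k = a' * q - a * q'" "k > 0" using V by (auto simp: k_def)
      have Nk: "N * real k \<le> t * real_of_int (q * q')" using V(9) unfolding k(1)[symmetric] by simp
      have "k \<le> K"
      proof -
        have "0 < N * real k" using N k by simp
        then have "0 < t * real_of_int (q * q')" using Nk by linarith
        moreover have "real_of_int (q * q') > 0" using V by simp
        ultimately have "t > 0" by (rule zero_less_mult_pos2)
        moreover have "real_of_int (q * q') \<le> real Q ^ 2"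
          using V unfolding power2_eq_square of_int_mult by (intro mult_mono) auto
        ultimately have "N * real k \<le> t * real Q ^ 2"
          using Nk by (meson mult_left_mono less_imp_le order_trans)
        with K have "N * real k \<le> N * real K" by (simp add: mult.commute)
        then show ?thesis using N by simp
      qed
      obtain b0 u where "b0 * q + u * a = 1"
        using V(4) bezout_int[of q a] by (auto simp: coprime_iff_gcd_eq_1)
      then obtain p0 where uni: "b0 * q - a * p0 = 1" by (intro that[of "-u"]) (simp add: algebra_simps)
      \<comment> \<open>Cramer's rule: the coordinates of the second vector in the basis are \<open>j0\<close> and \<open>k\<close>.\<close>
      define j0 where "j0 = b0 * q' - p0 * a'"
      have q': "j0 * q + int k * p0 = q'"
      proof -
        have "j0 * q + int k * p0 = q' * (b0 * q - a * p0)" unfolding k j0_def by (simp add: algebra_simps)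
        then show ?thesis using uni by simp
      qed
      have a': "j0 * a + int k * b0 = a'"
      proof -
        have "j0 * a + int k * b0 = a' * (b0 * q - a * p0)" unfolding k j0_def by (simp add: algebra_simps)
        then show ?thesis using uni by simp
      qed
      obtain m where m: "1 \<le> j0 + m * int k" "j0 + m * int k \<le> int k"
        using ex_representative_between[of "int k" j0] k by auto
      define j where "j = nat (j0 + m * int k)"
      have j: "int j = j0 + m * int k" using m by (simp add: j_def)
      define p where "p = p0 - m * q"
      define b where "b = b0 - m * a"
      have jq: "int j * q + int k * p = q'" "int j * a + int k * b = a'"
        unfolding j p_def b_def using q' a' by (simp_all add: algebra_simps)
      have "coprime (int j) (int k)"
      proof (rule coprimeI)
        fix c assume "c dvd int j" "c dvd int k"
        then have "c dvd q'" "c dvd a'" unfolding jq[symmetric] by (auto intro: dvd_add dvd_mult2)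
        then show "is_unit c" using V(7) coprime_common_divisor by blast
      qed
      moreover have "0 < int j" "int j \<le> int k" using m unfolding j by linarith+
      ultimately have "j \<in> totatives k" by (simp add: in_totatives_iff)
      moreover have "b * q - a * p = 1" using uni by (simp add: p_def b_def algebra_simps)
      ultimately have "(k, j, (q, a), (p, b)) \<in> based_pairs Q N t K"
        using V Nk k(2) \<open>k \<le> K\<close> jq by (simp add: based_pairs_def del: of_int_mult)
      moreover have "f (k, j, (q, a), (p, b)) = v" by (simp add: f_def v jq)
      ultimately show "v \<in> f ` based_pairs Q N t K" by force
    qed
  qed
qed

text \<open>The first coordinates of \<open>v\<close> and \<open>u\<close>. All size conditions involve only these, and any coprime \<open>q\<close> and
\<open>p\<close> extend to a basis in exactly one way with \<open>1 \<le> a \<le> q\<close>, as \<open>a\<close> is determined modulo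
\<open>q\<close> by \<open>a p \<equiv> - 1\<close>.\<close>
definition coordinate_pairs :: "nat \<Rightarrow> real \<Rightarrow> real \<Rightarrow> nat \<Rightarrow> nat \<Rightarrow> (int \<times> int) set" where
  "coordinate_pairs Q N t k j = {(q, p). 1 \<le> q \<and> q \<le> int Q \<and> coprime q p \<and>
      1 \<le> int j * q + int k * p \<and> int j * q + int k * p \<le> int Q \<and>
      N * real k \<le> t * real_of_int (q * (int j * q + int k * p))}"

lemma finite_coordinate_pairs:
  assumes "k > 0"
  shows "finite (coordinate_pairs Q N t k j)"
proof (rule finite_subset)
  show "coordinate_pairs Q N t k j \<subseteq> {1..int Q} \<times> {- (int j * int Q)..int Q}"
  proof (clarsimp simp: coordinate_pairs_def)
    fix q p assume q: "1 \<le> q" "q \<le> int Q" and z: "1 \<le> int j * q + int k * p" "int j * q + int k * p \<le> int Q"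
    have jq: "0 \<le> int j * q" "int j * q \<le> int j * int Q" using q by (auto intro: mult_left_mono)
    show "- (int j * int Q) \<le> p \<and> p \<le> int Q"
    proof (cases "p \<ge> 0")
      case True
      have "1 * p \<le> int k * p" using True assms by (intro mult_right_mono) auto
      moreover have "0 \<le> int j * int Q" by simp
      ultimately show ?thesis using z jq True by linarith
    next
      case False
      have "int k * p \<le> 1 * p" using False assms by (intro mult_right_mono_neg) auto
      then show ?thesis using z jq False by linarith
    qed
  qed
qed simp

lemma card_based_pairs:
  "card (based_pairs Q N t K) = (\<Sum>k\<in>{1..K}. \<Sum>j\<in>totatives k. card (coordinate_pairs Q N t k j))"
proof -
  let ?T = "SIGMA k:{1..K}. SIGMA j:totatives k. coordinate_pairs Q N t k j"
  define g :: "nat \<times> nat \<times> (int \<times> int) \<times> (int \<times> int) \<Rightarrow> nat \<times> nat \<times> int \<times> int" where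
    "g = (\<lambda>(k, j, (q, a), (p, b)). (k, j, q, p))"
  have "bij_betw g (based_pairs Q N t K) ?T"
  proof (rule bij_betw_imageI)
    show "inj_on g (based_pairs Q N t K)"
    proof (rule inj_onI)
      fix u v assume uv: "u \<in> based_pairs Q N t K" "v \<in> based_pairs Q N t K" "g u = g v"
      obtain k j q a p b where u: "u = (k, j, (q, a), (p, b))" by (metis surj_pair)
      obtain k' j' q' a' p' b' where v: "v = (k', j', (q', a'), (p', b'))" by (metis surj_pair)
      note 1 = uv(1)[unfolded u] and 2 = uv(2)[unfolded v] and eq = uv(3)[unfolded u v]
      have [simp]: "k' = k" "j' = j" "q' = q" "p' = p" using eq by (auto simp: g_def)
      have uni: "b * q - a * p = 1" "b' * q - a' * p = 1" and a: "1 \<le> a" "a \<le> q" "1 \<le> a'" "a' \<le> q"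
        using 1 2 by (auto simp: based_pairs_def)
      have "coprime q p" using coprime_if_int_combination[of q b p "-a"] uni(1) by (simp add: algebra_simps)
      moreover have "(a - a') * p = q * (b - b')" using uni by (simp add: algebra_simps)
      then have "q dvd (a - a') * p" by simp
      ultimately have "q dvd a - a'" by (simp add: coprime_dvd_mult_left_iff)
      moreover have "\<bar>a - a'\<bar> < q" using a by linarith
      ultimately have "a - a' = 0" by (rule int_dvd_abs_less_imp_eq_0)
      then have aa: "a' = a" by simp
      have "b * q = b' * q" using uni unfolding aa by linarith
      then show "u = v" using a by (simp add: u v aa)
    qed
    show "g ` based_pairs Q N t K = ?T"
    proof (intro equalityI subsetI)
      fix x assume "x \<in> g ` based_pairs Q N t K"
      then obtain k j q a p b where B: "(k, j, (q, a), (p, b)) \<in> based_pairs Q N t K" and x: "x = (k, j, q, p)"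
        by (auto simp: g_def)
      have "coprime q p" using coprime_if_int_combination[of q b p "-a"] B by (simp add: based_pairs_def algebra_simps)
      then show "x \<in> ?T" using B unfolding x by (auto simp: based_pairs_def coordinate_pairs_def)
    next
      fix x assume "x \<in> ?T"
      then obtain k j q p where x: "x = (k, j, q, p)" "k \<in> {1..K}" "j \<in> totatives k"
        and C: "(q, p) \<in> coordinate_pairs Q N t k j" by auto
      have q: "q > 0" "coprime q p" using C by (auto simp: coordinate_pairs_def)
      obtain b0 u where "b0 * q + u * p = 1"
        using q(2) bezout_int[of q p] by (auto simp: coprime_iff_gcd_eq_1)
      then obtain a0 where uni: "b0 * q - a0 * p = 1" by (intro that[of "-u"]) (simp add: algebra_simps)
      obtain m where m: "1 \<le> a0 + m * q" "a0 + m * q \<le> q"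
        using ex_representative_between[OF q(1), of a0] by auto
      have "(b0 + m * p) * q - (a0 + m * q) * p = 1" using uni by (simp add: algebra_simps)
      then have "(k, j, (q, a0 + m * q), (p, b0 + m * p)) \<in> based_pairs Q N t K"
        using m C x by (auto simp: based_pairs_def coordinate_pairs_def)
      moreover have "g (k, j, (q, a0 + m * q), (p, b0 + m * p)) = x" by (simp add: g_def x)
      ultimately show "x \<in> g ` based_pairs Q N t K" by force
    qed
  qed
  then have "card (based_pairs Q N t K) = card ?T" by (rule bij_betw_same_card)
  also have "\<dots> = (\<Sum>k\<in>{1..K}. card (SIGMA j:totatives k. coordinate_pairs Q N t k j))"
    by (intro card_SigmaI) (auto intro!: finite_SigmaI finite_coordinate_pairs)
  also have "\<dots> = (\<Sum>k\<in>{1..K}. \<Sum>j\<in>totatives k. card (coordinate_pairs Q N t k j))"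
    by (intro sum.cong refl card_SigmaI) (auto intro!: finite_coordinate_pairs)
  finally show ?thesis .
qed

lemma card_farey_pairs:
  assumes "N > 0" "t < N" "t * real Q ^ 2 \<le> real K * N"
  shows "card {(x, y). x \<in> farey Q \<and> y \<in> farey Q \<and> x \<noteq> y \<and> N * frac (x - y) \<le> t} =
         (\<Sum>k\<in>{1..K}. \<Sum>j\<in>totatives k. card (coordinate_pairs Q N t k j))"
  using card_farey_pairs_eq_vector_pairs[OF assms(1,2)] card_vector_pairs_eq_based_pairs[OF assms(1,3)]
    card_based_pairs by simp

section \<open>Areas cut off by a hyperbola\<close>

text \<open>The area of the set of points \<open>(x, z)\<close> of the unit square with \<open>s x z \<ge> 1\<close>. The maximum covers
the values \<open>s < 1\<close>, where this set is empty, with a single differentiable formula.\<close>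
definition hyperbola_area :: "real \<Rightarrow> real" where
  "hyperbola_area s = (let m = max 1 s in 1 - 1 / m - ln m / m)"

text \<open>The scaled coordinates \<open>x = q / Q\<close>, \<open>y = p / Q\<close> of the pairs in \<open>coordinate_pairs\<close>. The parameter
\<open>s\<close>, rather than its inverse, makes the region increase with \<open>s\<close> and covers \<open>s \<le> 0\<close> as well.\<close>
definition hyperbola_region :: "nat \<Rightarrow> nat \<Rightarrow> real \<Rightarrow> (real \<times> real) set" where
  "hyperbola_region k j s = {(x, y). 0 < x \<and> x \<le> 1 \<and> 0 < real j * x + real k * y \<and>
      real j * x + real k * y \<le> 1 \<and> 1 \<le> s * (x * (real j * x + real k * y))}"

definition farey_triangle :: "(real \<times> real) set" where
  "farey_triangle = {(x, y). 0 < y \<and> y \<le> x \<and> x \<le> 1}"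

text \<open>Expanding the product at a convex combination leaves the mixed term \<open>x1 z2 + x2 z1\<close>, which is at least
twice the geometric mean of \<open>x1 z1\<close> and \<open>x2 z2\<close>.\<close>
lemma convex_above_hyperbola:
  fixes s :: real
  assumes "s > 0"
  shows "convex {(x, z). 0 < x \<and> 0 < z \<and> 1 \<le> s * (x * z)}"
proof (rule convexI, clarsimp)
  fix u v x1 z1 x2 z2 :: real
  assume uv: "0 \<le> u" "0 \<le> v" "u + v = 1"
    and 1: "0 < x1" "0 < z1" "1 \<le> s * (x1 * z1)" and 2: "0 < x2" "0 < z2" "1 \<le> s * (x2 * z2)"
  have "1 * 1 \<le> (s * (x1 * z1)) * (s * (x2 * z2))" using 1 2 by (intro mult_mono) auto
  then have "2\<^sup>2 \<le> 4 * ((s * (x1 * z1)) * (s * (x2 * z2)))" by simp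
  also have "\<dots> \<le> 4 * ((s * (x1 * z1)) * (s * (x2 * z2))) + (s * (x1 * z2) - s * (x2 * z1))\<^sup>2" by simp
  also have "\<dots> = (s * (x1 * z2) + s * (x2 * z1))\<^sup>2"
    by (simp add: power2_eq_square algebra_simps)
  finally have "2\<^sup>2 \<le> (s * (x1 * z2) + s * (x2 * z1))\<^sup>2" .
  then have cross: "2 \<le> s * (x1 * z2) + s * (x2 * z1)"
    by (rule power2_le_imp_le) (use 1 2 assms in \<open>auto intro!: add_nonneg_nonneg mult_nonneg_nonneg\<close>)
  have "1 = (u + v)\<^sup>2" using uv(3) by simp
  also have "\<dots> = u\<^sup>2 * 1 + v\<^sup>2 * 1 + u * v * 2" by (simp add: power2_eq_square algebra_simps)
  also have "\<dots> \<le> u\<^sup>2 * (s * (x1 * z1)) + v\<^sup>2 * (s * (x2 * z2)) + u * v * (s * (x1 * z2) + s * (x2 * z1))"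
    using uv 1 2 cross by (intro add_mono mult_left_mono) auto
  also have "\<dots> = s * ((u * x1 + v * x2) * (u * z1 + v * z2))"
    by (simp add: power2_eq_square algebra_simps)
  finally have "1 \<le> s * ((u * x1 + v * x2) * (u * z1 + v * z2))" .
  moreover have "0 < u * x1 + v * x2" "0 < u * z1 + v * z2"
    using uv 1 2 by (cases "u = 0"; simp add: add_pos_nonneg)+
  ultimately show "0 < u * x1 + v * x2 \<and> 0 < u * z1 + v * z2 \<and>
      1 \<le> s * ((u * x1 + v * x2) * (u * z1 + v * z2))"
    by simp
qed

text \<open>The region is a linear preimage of a part of the unit square above a hyperbola.\<close>
lemma convex_hyperbola_region: "convex (hyperbola_region k j s)"
proof (cases "s > 0")
  case True
  have lin: "linear (\<lambda>(x, y). (x, real j * x + real k * y))"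
    by (auto simp: linear_iff algebra_simps)
  have "convex ({(x, z). 0 < x \<and> 0 < z \<and> 1 \<le> s * (x * z)} \<inter> ({..1} \<times> {..1}))"
    by (intro convex_Int convex_above_hyperbola convex_Times True) auto
  from convex_linear_vimage[OF lin this] show ?thesis
    by (rule back_subst[of convex]) (auto simp: hyperbola_region_def)
next
  case False
  have "s * (x * z) \<le> 0" if "0 < x" "0 < z" for x z
    using False that by (intro mult_nonpos_nonneg) auto
  then have "hyperbola_region k j s = {}"
    by (fastforce simp: hyperbola_region_def)
  then show ?thesis by simp
qed

lemma bounded_hyperbola_region:
  assumes "k > 0"
  shows "bounded (hyperbola_region k j s)"
proof (rule bounded_subset)
  show "bounded ({0..1} \<times> {- real j..1 :: real} :: (real \<times> real) set)"
    by (intro bounded_Times) auto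
  show "hyperbola_region k j s \<subseteq> {0..1} \<times> {- real j..1}"
  proof (clarsimp simp: hyperbola_region_def)
    fix x y :: real
    assume x: "0 < x" "x \<le> 1" and z: "0 < real j * x + real k * y" "real j * x + real k * y \<le> 1"
    have jx: "0 \<le> real j * x" "real j * x \<le> real j * 1" using x by (auto intro!: mult_left_mono simp del: mult_1_right)
    show "- real j \<le> y \<and> y \<le> 1"
    proof (cases "y \<ge> 0")
      case True
      have "1 * y \<le> real k * y" using True assms by (intro mult_right_mono) auto
      then show ?thesis using z jx True by linarith
    next
      case False
      have "real k * y \<le> 1 * y" using False assms by (intro mult_right_mono_neg) auto
      then show ?thesis using z jx False by linarith
    qed
  qed
qed

lemma hyperbola_region_mono: "s \<le> s' \<Longrightarrow> hyperbola_region k j s \<subseteq> hyperbola_region k j s'"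
proof (clarsimp simp: hyperbola_region_def)
  fix x y :: real
  assume "s \<le> s'" "0 < x" "0 < real j * x + real k * y" "1 \<le> s * (x * (real j * x + real k * y))"
  then show "1 \<le> s' * (x * (real j * x + real k * y))"
    by (meson mult_pos_pos mult_right_mono less_imp_le order_trans)
qed

lemma measure_by_slices:
  fixes \<Omega> :: "(real \<times> real) set"
  assumes borel: "\<Omega> \<in> sets borel" and f: "f \<in> borel_measurable borel" and "a \<le> b"
    and slice: "\<And>x. a \<le> x \<Longrightarrow> x \<le> b \<Longrightarrow> emeasure lborel {y. (x, y) \<in> \<Omega>} = ennreal (f x)"
    and outside: "\<And>x y. (x, y) \<in> \<Omega> \<Longrightarrow> a \<le> x \<and> x \<le> b"
    and deriv: "\<And>x. a \<le> x \<Longrightarrow> x \<le> b \<Longrightarrow> (F has_real_derivative f x) (at x)"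
    and nonneg: "\<And>x. a \<le> x \<Longrightarrow> x \<le> b \<Longrightarrow> 0 \<le> f x"
  shows "measure lebesgue \<Omega> = F b - F a"
proof -
  have "emeasure lborel \<Omega> = emeasure (lborel \<Otimes>\<^sub>M lborel) \<Omega>" by (simp add: lborel_prod)
  also have "\<dots> = (\<integral>\<^sup>+x. emeasure lborel (Pair x -` \<Omega>) \<partial>lborel)"
    using borel by (intro lborel.emeasure_pair_measure_alt, subst lborel_prod) simp
  also have "\<dots> = (\<integral>\<^sup>+x. ennreal (f x) * indicator {a..b} x \<partial>lborel)"
  proof (intro nn_integral_cong)
    fix x :: real
    show "emeasure lborel (Pair x -` \<Omega>) = ennreal (f x) * indicator {a..b} x"
    proof (cases "x \<in> {a..b}")
      case True
      then show ?thesis using slice[of x] by (simp add: vimage_def)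
    next
      case False
      then have "Pair x -` \<Omega> = {}" using outside by auto
      then show ?thesis using False by simp
    qed
  qed
  also have "\<dots> = ennreal (F b - F a)"
    by (rule nn_integral_FTC_Icc) (use f deriv nonneg \<open>a \<le> b\<close> in auto)
  finally have "emeasure lborel \<Omega> = ennreal (F b - F a)" .
  moreover have "F a \<le> F b"
    by (rule DERIV_nonneg_imp_nondecreasing[OF \<open>a \<le> b\<close>]) (use deriv nonneg in blast)
  ultimately have "measure lborel \<Omega> = F b - F a" by (simp add: measure_def)
  then show ?thesis using borel by simp
qed

lemma measure_farey_triangle: "measure lebesgue farey_triangle = 1 / 2"
proof -
  have "measure lebesgue farey_triangle = 1\<^sup>2 / 2 - 0\<^sup>2 / (2::real)"
  proof (rule measure_by_slices[where f = "\<lambda>x. x" and F = "\<lambda>x. x\<^sup>2 / 2" and a = 0 and b = 1])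
    have "farey_triangle = {z. 0 < snd z} \<inter> {z. snd z \<le> fst z} \<inter> {z. fst z \<le> 1}"
      by (auto simp: farey_triangle_def)
    also have "\<dots> \<in> sets borel"
      by (intro sets.Int borel_open[OF open_Collect_less] borel_closed[OF closed_Collect_le] continuous_intros)
    finally show "farey_triangle \<in> sets borel" .
    fix x :: real assume x: "0 \<le> x" "x \<le> 1"
    then have "{y. (x, y) \<in> farey_triangle} = {0<..x}" by (auto simp: farey_triangle_def)
    then show "emeasure lborel {y. (x, y) \<in> farey_triangle} = ennreal x" using x by simp
    show "((\<lambda>x. x\<^sup>2 / 2) has_real_derivative x) (at x)" by (auto intro!: derivative_eq_intros)
  qed (auto simp: farey_triangle_def)
  then show ?thesis by simp
qed

text \<open>The slice at \<open>x\<close> is an interval of length \<open>(1 - 1 / (s x)) / k\<close> for \<open>1 / s \<le> x \<le> 1\<close>: the summand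
\<open>j x\<close> only translates it, which is why the area does not depend on \<open>j\<close>.\<close>
lemma measure_hyperbola_region:
  assumes "k > 0"
  shows "measure lebesgue (hyperbola_region k j s) = hyperbola_area s / real k"
proof (cases "s \<ge> 1")
  case False
  have "hyperbola_region k j s = {}"
  proof (rule ccontr)
    assume "hyperbola_region k j s \<noteq> {}"
    then obtain x y where x: "0 < x" "x \<le> 1" and z: "0 < real j * x + real k * y" "real j * x + real k * y \<le> 1"
      and s: "1 \<le> s * (x * (real j * x + real k * y))" by (auto simp: hyperbola_region_def)
    have xz: "0 \<le> x * (real j * x + real k * y)" "x * (real j * x + real k * y) \<le> 1"
      using x z by (auto intro: mult_le_one)
    have "s * (x * (real j * x + real k * y)) \<le> max 0 s * 1"
      using xz by (intro mult_mono) auto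
    then show False using s False by auto
  qed
  then show ?thesis using False by (simp add: hyperbola_area_def)
next
  case True
  define F where "F x = (x - ln x / s) / real k" for x
  have "measure lebesgue (hyperbola_region k j s) = F 1 - F (1 / s)"
  proof (rule measure_by_slices[where f = "\<lambda>x. (1 - 1 / (s * x)) / real k" and F = F and a = "1 / s" and b = 1])
    have "hyperbola_region k j s = {z. 0 < fst z} \<inter> {z. fst z \<le> 1} \<inter> {z. 0 < real j * fst z + real k * snd z}
       \<inter> {z. real j * fst z + real k * snd z \<le> 1} \<inter> {z. 1 \<le> s * (fst z * (real j * fst z + real k * snd z))}"
      by (auto simp: hyperbola_region_def)
    also have "\<dots> \<in> sets borel"
      by (intro sets.Int borel_open[OF open_Collect_less] borel_closed[OF closed_Collect_le] continuous_intros)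
    finally show "hyperbola_region k j s \<in> sets borel" .
    show "(\<lambda>x. (1 - 1 / (s * x)) / real k) \<in> borel_measurable borel" by measurable
    show "1 / s \<le> 1" using True by simp
    fix x y assume "(x, y) \<in> hyperbola_region k j s"
    then have x: "0 < x" "x \<le> 1" and z: "real j * x + real k * y \<le> 1"
      and s: "1 \<le> s * (x * (real j * x + real k * y))" by (auto simp: hyperbola_region_def)
    have "s * (x * (real j * x + real k * y)) \<le> s * (x * 1)"
      using z x True by (intro mult_left_mono) auto
    then show "1 / s \<le> x \<and> x \<le> 1" using s x True by (simp add: field_simps)
  next
    fix x :: real assume x: "1 / s \<le> x" "x \<le> 1"
    have "0 < 1 / s" using True by simp
    then have x0: "x > 0" using x by linarith
    have sx: "1 \<le> s * x" using x True by (simp add: field_simps)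
    have "{y. (x, y) \<in> hyperbola_region k j s} = {(1 / (s * x) - real j * x) / real k..(1 - real j * x) / real k}"
    proof (intro set_eqI)
      fix y
      let ?z = "real j * x + real k * y"
      have "1 \<le> s * (x * ?z) \<longleftrightarrow> 1 / (s * x) \<le> ?z" using x0 True by (simp add: field_simps)
      moreover have "0 < ?z" if "1 / (s * x) \<le> ?z"
        using that x0 True by (meson less_le_trans divide_pos_pos mult_pos_pos zero_less_one)
      ultimately have "(x, y) \<in> hyperbola_region k j s \<longleftrightarrow> 1 / (s * x) \<le> ?z \<and> ?z \<le> 1"
        using x x0 by (auto simp: hyperbola_region_def)
      also have "\<dots> \<longleftrightarrow> y \<in> {(1 / (s * x) - real j * x) / real k..(1 - real j * x) / real k}"
      proof -
        have "(1 / (s * x) - real j * x) / real k \<le> y \<longleftrightarrow> 1 / (s * x) - real j * x \<le> real k * y"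
          using assms by (simp add: pos_divide_le_eq mult.commute)
        moreover have "y \<le> (1 - real j * x) / real k \<longleftrightarrow> real k * y \<le> 1 - real j * x"
          using assms by (simp add: pos_le_divide_eq mult.commute)
        ultimately show ?thesis by (simp only: atLeastAtMost_iff) auto
      qed
      finally show "y \<in> {y. (x, y) \<in> hyperbola_region k j s} \<longleftrightarrow>
          y \<in> {(1 / (s * x) - real j * x) / real k..(1 - real j * x) / real k}" by simp
    qed
    moreover have "(1 / (s * x) - real j * x) / real k \<le> (1 - real j * x) / real k"
      using sx assms by (intro divide_right_mono) auto
    ultimately show "emeasure lborel {y. (x, y) \<in> hyperbola_region k j s} = ennreal ((1 - 1 / (s * x)) / real k)"
      by (simp flip: diff_divide_distrib)
    show "(F has_real_derivative (1 - 1 / (s * x)) / real k) (at x)"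
      unfolding F_def using x0 True assms by (auto intro!: derivative_eq_intros)
    show "0 \<le> (1 - 1 / (s * x)) / real k" using sx by simp
  qed
  also have "\<dots> = hyperbola_area s / real k"
    using True assms by (simp add: F_def hyperbola_area_def max_def ln_div field_simps)
  finally show ?thesis .
qed

lemma isCont_hyperbola_area: "isCont hyperbola_area s"
  unfolding hyperbola_area_def [abs_def] Let_def by (intro continuous_intros) auto

lemma hyperbola_area_bounds:
  assumes "s \<ge> 1"
  shows "0 \<le> hyperbola_area s" "hyperbola_area s \<le> (s - 1)\<^sup>2"
proof -
  have *: "hyperbola_area s = (s - 1 - ln s) / s"
    using assms by (simp add: hyperbola_area_def field_simps)
  show "0 \<le> hyperbola_area s" unfolding * using assms ln_le_minus_one[of s] by simp
  have "ln (1 / s) \<le> 1 / s - 1" using assms by (intro ln_le_minus_one) auto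
  then have "1 - 1 / s \<le> ln s" using assms by (simp add: ln_div)
  then have "hyperbola_area s \<le> (s - 1 - (1 - 1 / s)) / s"
    unfolding * using assms by (intro divide_right_mono) auto
  also have "\<dots> = ((s - 1) / s)\<^sup>2" using assms by (simp add: field_simps power2_eq_square)
  also have "\<dots> \<le> (s - 1)\<^sup>2"
  proof (intro power_mono)
    have "(s - 1) / s \<le> (s - 1) / 1" using assms by (intro divide_left_mono) auto
    then show "(s - 1) / s \<le> s - 1" by simp
  qed (use assms in auto)
  finally show "hyperbola_area s \<le> (s - 1)\<^sup>2" .
qed

text \<open>At \<open>s = 1\<close>, where the two branches meet, the derivative vanishes because the area is between \<open>0\<close>
and \<open>(s - 1)\<^sup>2\<close>.\<close>
lemma hyperbola_area_deriv:
  assumes "s \<ge> 0"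
  shows "(hyperbola_area has_real_derivative max 0 (ln s) / s\<^sup>2) (at s)"
proof -
  consider "s < 1" | "s = 1" | "s > 1" by linarith
  then show ?thesis
  proof cases
    case 1
    have "\<forall>\<^sub>F x in nhds s. 0 = hyperbola_area x"
      using eventually_nhds_in_open[of "{..<1}" s] 1
      by (auto elim!: eventually_mono simp: hyperbola_area_def)
    from DERIV_cong_ev[OF refl this refl, of 0] have "(hyperbola_area has_real_derivative 0) (at s)"
      by simp
    moreover have "ln s \<le> 0" using 1 assms by (cases "s = 0") auto
    ultimately show ?thesis by simp
  next
    case 3
    have deriv: "((\<lambda>m. 1 - 1 / m - ln m / m) has_real_derivative ln s / s\<^sup>2) (at s)"
      using 3 by (auto intro!: derivative_eq_intros simp: field_simps power2_eq_square)
    have "\<forall>\<^sub>F x in nhds s. 1 - 1 / x - ln x / x = hyperbola_area x"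
      using eventually_nhds_in_open[of "{1<..}" s] 3
      by (auto elim!: eventually_mono simp: hyperbola_area_def max_def)
    from DERIV_cong_ev[OF refl this refl] have "(hyperbola_area has_real_derivative ln s / s\<^sup>2) (at s)"
      using deriv by blast
    then show ?thesis using 3 by simp
  next
    case 2
    have le: "\<bar>hyperbola_area x\<bar> \<le> \<bar>x - 1\<bar> * \<bar>x - 1\<bar>" for x
      using hyperbola_area_bounds[of x] 
      by (cases "x \<ge> 1") (auto simp: power2_eq_square hyperbola_area_def)
    have "((\<lambda>x. (hyperbola_area x - hyperbola_area 1) / (x - 1)) \<longlongrightarrow> 0) (at 1)"
    proof (rule Lim_null_comparison)
      show "\<forall>\<^sub>F x in at 1. norm ((hyperbola_area x - hyperbola_area 1) / (x - 1)) \<le> \<bar>x - 1\<bar>"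
        using le by (auto simp: eventually_at_filter hyperbola_area_def[of 1] field_simps)
      show "((\<lambda>x::real. \<bar>x - 1\<bar>) \<longlongrightarrow> 0) (at 1)" by (auto intro!: tendsto_eq_intros)
    qed
    then show ?thesis using 2 by (simp add: has_field_derivative_iff)
  qed
qed

section \<open>The limit of the pair counts\<close>

text \<open>Pointwise limits of monotone functions, evaluated along a convergent argument: \<open>h n (X n)\<close> is
trapped between values of \<open>h n\<close> at fixed points on either side of \<open>x\<close>. It is needed because the size of
the Farey set enters the hyperbola, and because the endpoints of intervals are approached from the left.\<close>
lemma tendsto_mono_fun_compose:
  fixes h :: "nat \<Rightarrow> real \<Rightarrow> real" and g :: "real \<Rightarrow> real"
  assumes mono: "\<And>n. mono (h n)"
    and lim: "\<And>y. y < b \<Longrightarrow> (\<lambda>n. h n y) \<longlonglongrightarrow> g y"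
    and cont: "isCont g x" and x: "x < b" "X \<longlonglongrightarrow> x"
  shows "(\<lambda>n. h n (X n)) \<longlonglongrightarrow> g x"
proof (rule order_tendstoI)
  fix l assume l: "l < g x"
  have "(g \<longlongrightarrow> g x) (at_left x)" using cont by (simp add: isCont_def filterlim_at_split)
  then have "\<forall>\<^sub>F y in at_left x. l < g y" using l by (rule order_tendstoD)
  moreover have "\<forall>\<^sub>F y in at_left x. y < x" by (simp add: eventually_at_filter)
  ultimately have "\<forall>\<^sub>F y in at_left x. l < g y \<and> y < x" by eventually_elim simp
  then obtain y where y: "l < g y" "y < x"
    using eventually_happens'[OF trivial_limit_at_left_real] by blast
  have "\<forall>\<^sub>F n in sequentially. l < h n y" using lim[of y] y x by (intro order_tendstoD) auto
  moreover have "\<forall>\<^sub>F n in sequentially. y < X n" using x(2) y by (intro order_tendstoD)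
  ultimately show "\<forall>\<^sub>F n in sequentially. l < h n (X n)"
  proof eventually_elim
    case (elim n)
    then show ?case using monoD[OF mono[of n], of y "X n"] by linarith
  qed
next
  fix l assume l: "g x < l"
  have "(g \<longlongrightarrow> g x) (at_right x)" using cont by (simp add: isCont_def filterlim_at_split)
  then have "\<forall>\<^sub>F y in at_right x. g y < l" using l by (rule order_tendstoD)
  moreover have "\<forall>\<^sub>F y in at_right x. y < b" using x(1) by (rule eventually_at_right_real[THEN eventually_mono]) auto
  moreover have "\<forall>\<^sub>F y in at_right x. x < y" by (simp add: eventually_at_filter)
  ultimately have "\<forall>\<^sub>F y in at_right x. g y < l \<and> y < b \<and> x < y" by eventually_elim simp
  then obtain y where y: "g y < l" "y < b" "x < y"
    using eventually_happens'[OF trivial_limit_at_right_real] by blast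
  have "\<forall>\<^sub>F n in sequentially. h n y < l" using lim[of y] y by (intro order_tendstoD) auto
  moreover have "\<forall>\<^sub>F n in sequentially. X n < y" using x(2) y by (intro order_tendstoD)
  ultimately show "\<forall>\<^sub>F n in sequentially. h n (X n) < l"
  proof eventually_elim
    case (elim n)
    then show ?case using monoD[OF mono[of n], of "X n" y] by linarith
  qed
qed

text \<open>The Farey fractions are the primitive points of a dilated triangle of area \<open>1 / 2\<close>.\<close>
lemma card_farey_tendsto: "(\<lambda>Q. real (card (farey Q)) / real Q ^ 2) \<longlonglongrightarrow> 3 / pi\<^sup>2"
proof -
  have "convex farey_triangle"
    unfolding convex_def farey_triangle_def
  proof clarsimp
    fix u v x1 y1 x2 y2 :: real
    assume uv: "0 \<le> u" "0 \<le> v" "u + v = 1" and 1: "0 < y1" "y1 \<le> x1" "x1 \<le> 1" and 2: "0 < y2" "y2 \<le> x2" "x2 \<le> 1"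
    have "0 < u * y1 + v * y2" using uv 1 2 by (cases "u = 0") (auto simp: add_pos_nonneg)
    moreover have "u * y1 + v * y2 \<le> u * x1 + v * x2" using uv 1 2 by (intro add_mono mult_left_mono) auto
    moreover have "u * x1 + v * x2 \<le> u * 1 + v * 1" using uv 1 2 by (intro add_mono mult_left_mono) auto
    ultimately show "0 < u * y1 + v * y2 \<and> u * y1 + v * y2 \<le> u * x1 + v * x2 \<and> u * x1 + v * x2 \<le> 1"
      using uv by simp
  qed
  moreover have "bounded farey_triangle"
    by (rule bounded_subset[of "{0..1} \<times> {0..1}"]) (auto simp: farey_triangle_def intro: bounded_Times)
  moreover have "(0, 0) \<notin> farey_triangle" by (simp add: farey_triangle_def)
  ultimately have "((\<lambda>T. real (card {(m, n)\<in>lattice_points farey_triangle T. coprime m n}) / T\<^sup>2)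
            \<longlongrightarrow> 6 / pi\<^sup>2 * measure lebesgue farey_triangle) at_top"
    by (rule primitive_lattice_point_count)
  from filterlim_compose[OF this filterlim_real_sequentially]
  have "(\<lambda>Q. real (card {(m, n)\<in>lattice_points farey_triangle (real Q). coprime m n}) / (real Q)\<^sup>2) \<longlonglongrightarrow> 3 / pi\<^sup>2"
    by (simp add: measure_farey_triangle)
  moreover have "\<forall>\<^sub>F Q in sequentially. real (card {(m, n)\<in>lattice_points farey_triangle (real Q). coprime m n}) / (real Q)\<^sup>2
      = real (card (farey Q)) / real Q ^ 2"
    using eventually_gt_at_top[of 0]
  proof eventually_elim
    case (elim Q)
    have "{(m, n)\<in>lattice_points farey_triangle (real Q). coprime m n} =
          {(q, a). 1 \<le> a \<and> a \<le> q \<and> q \<le> int Q \<and> coprime q a}"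
      using elim by (auto simp: lattice_points_def farey_triangle_def divide_right_mono zero_less_divide_iff
          divide_le_cancel divide_le_eq_1)
    then show ?case using bij_betw_same_card[OF bij_betw_farey[of Q]] by simp
  qed
  ultimately show ?thesis by (rule Lim_transform_eventually)
qed

lemma eventually_card_farey_ge: "\<forall>\<^sub>F Q in sequentially. real Q ^ 2 / 6 \<le> real (card (farey Q)) \<and> Q > 0"
proof -
  have "pi\<^sup>2 < 4\<^sup>2" using pi_less_4 pi_gt_zero by (intro power_strict_mono) auto
  then have "1 / 6 < 3 / pi\<^sup>2" by (simp add: field_simps)
  from order_tendstoD(1)[OF card_farey_tendsto this] eventually_gt_at_top[of 0]
  show ?thesis by eventually_elim (auto simp: field_simps)
qed

lemma eventually_card_farey_gt: "\<forall>\<^sub>F Q in sequentially. C < real (card (farey Q))"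
proof -
  have "filterlim (\<lambda>Q. real Q ^ 2 / 6) at_top sequentially"
    using filterlim_tendsto_pos_mult_at_top[OF tendsto_const[of "1/6 :: real"] _
        filterlim_pow_at_top[OF _ filterlim_real_sequentially, of 2]] by simp
  then have "\<forall>\<^sub>F Q in sequentially. C < real Q ^ 2 / 6" by (simp add: filterlim_at_top_dense)
  with eventually_card_farey_ge show ?thesis by eventually_elim linarith
qed

text \<open>The distribution function of the pair correlation at level \<open>Q\<close>: on the circle, \<open>frac (x - y)\<close> is the
distance from \<open>y\<close> to \<open>x\<close> in the positive direction.\<close>
definition farey_gap_ratio :: "nat \<Rightarrow> real \<Rightarrow> real" where
  "farey_gap_ratio Q t = real (card {(x, y). x \<in> farey Q \<and> y \<in> farey Q \<and> x \<noteq> y \<and>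
      real (card (farey Q)) * frac (x - y) \<le> t}) / real (card (farey Q))"

lemma finite_farey_pairs: "finite {(x, y). x \<in> farey Q \<and> y \<in> farey Q \<and> P x y}"
  by (rule finite_subset[of _ "farey Q \<times> farey Q"]) (auto simp: finite_farey)

lemma mono_farey_gap_ratio: "mono (farey_gap_ratio Q)"
  unfolding farey_gap_ratio_def
  by (intro monoI divide_right_mono of_nat_mono card_mono finite_farey_pairs) auto

lemma coordinate_pairs_eq_lattice_points:
  assumes "Q > 0" "N > 0" "k > 0"
  shows "coordinate_pairs Q N t k j =
    {(q, p)\<in>lattice_points (hyperbola_region k j (t * real Q ^ 2 / (N * real k))) (real Q). coprime q p}"
proof -
  have *: "((1::real) \<le> t * real Q ^ 2 / (N * real k) *
      (real_of_int q / real Q * (real j * (real_of_int q / real Q) + real k * (real_of_int p / real Q)))) \<longleftrightarrow>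
      N * real k \<le> t * real_of_int (q * (int j * q + int k * p))" for q p
  proof -
    have "t * real Q ^ 2 / (N * real k) *
      (real_of_int q / real Q * (real j * (real_of_int q / real Q) + real k * (real_of_int p / real Q))) =
      t * real_of_int (q * (int j * q + int k * p)) / (N * real k)"
      using assms by (simp add: field_simps power2_eq_square)
    then show ?thesis using assms by (simp add: pos_le_divide_eq)
  qed
  have **: "real j * (real_of_int q / real Q) + real k * (real_of_int p / real Q) =
      real_of_int (int j * q + int k * p) / real Q" for q p
    by (simp add: add_divide_distrib)
  have z: "0 < real_of_int z / real Q \<longleftrightarrow> 1 \<le> z" "real_of_int z / real Q \<le> 1 \<longleftrightarrow> z \<le> int Q" for z
    using assms(1) by (auto simp: zero_less_divide_iff divide_le_eq_1)
  have "(q, p) \<in> coordinate_pairs Q N t k j \<longleftrightarrow>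
      (q, p) \<in> lattice_points (hyperbola_region k j (t * real Q ^ 2 / (N * real k))) (real Q) \<and> coprime q p" for q p
    unfolding coordinate_pairs_def lattice_points_def hyperbola_region_def mem_Collect_eq case_prod_conv *
    unfolding ** z by blast
  then show ?thesis by auto
qed

text \<open>The count is asymptotic to \<open>6 / \<pi>\<^sup>2\<close> times \<open>Q\<^sup>2\<close> times the area, where the parameter
\<open>t Q\<^sup>2 / (N k)\<close> of the hyperbola varies with \<open>Q\<close> and tends to \<open>\<pi>\<^sup>2 t / (3 k)\<close>; division by
\<open>N\<close>, which is asymptotic to \<open>3 Q\<^sup>2 / \<pi>\<^sup>2\<close>, leaves the factor \<open>2\<close>.\<close>
lemma tendsto_card_coordinate_pairs:
  assumes "k > 0"
  shows "(\<lambda>Q. real (card (coordinate_pairs Q (real (card (farey Q))) t k j)) / real (card (farey Q)))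
     \<longlonglongrightarrow> 2 * hyperbola_area (pi\<^sup>2 * t / (3 * real k)) / real k"
proof -
  define h where "h Q s = real (card {(m, n)\<in>lattice_points (hyperbola_region k j s) (real Q). coprime m n}) / (real Q)\<^sup>2"
    for Q s
  define N where "N Q = real (card (farey Q))" for Q
  have N_lim: "(\<lambda>Q. real Q ^ 2 / N Q) \<longlonglongrightarrow> pi\<^sup>2 / 3"
    using tendsto_inverse[OF card_farey_tendsto] by (simp add: N_def field_simps)
  have mono: "mono (h Q)" for Q
  proof (cases "Q > 0")
    case True
    show ?thesis unfolding h_def
    proof (intro monoI divide_right_mono of_nat_mono card_mono)
      fix s s' :: real assume "s \<le> s'"
      then show "{(m, n). (m, n) \<in> lattice_points (hyperbola_region k j s) (real Q) \<and> coprime m n}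
            \<subseteq> {(m, n). (m, n) \<in> lattice_points (hyperbola_region k j s') (real Q) \<and> coprime m n}"
        using hyperbola_region_mono[of s s' k j] by (auto simp: lattice_points_def)
      show "finite {(m, n). (m, n) \<in> lattice_points (hyperbola_region k j s') (real Q) \<and> coprime m n}"
        by (rule finite_subset[OF _ finite_lattice_points[OF bounded_hyperbola_region[OF assms], of "real Q" j s']])
           (use True in auto)
    qed auto
  qed (auto simp: h_def mono_def)
  have lim: "(\<lambda>Q. h Q s) \<longlonglongrightarrow> 6 / pi\<^sup>2 * (hyperbola_area s / real k)" for s
  proof -
    have "(0, 0) \<notin> hyperbola_region k j s" by (simp add: hyperbola_region_def)
    from filterlim_compose[OF primitive_lattice_point_count[OF convex_hyperbola_region
          bounded_hyperbola_region[OF assms] this] filterlim_real_sequentially]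
    show ?thesis unfolding h_def measure_hyperbola_region[OF assms] .
  qed
  have cont: "isCont (\<lambda>s. 6 / pi\<^sup>2 * (hyperbola_area s / real k)) (pi\<^sup>2 / 3 * (t / real k))"
    using isCont_hyperbola_area assms by (intro continuous_intros) auto
  have "(\<lambda>Q. real Q ^ 2 / N Q * (t / real k)) \<longlonglongrightarrow> pi\<^sup>2 / 3 * (t / real k)"
    by (intro tendsto_mult N_lim tendsto_const)
  from tendsto_mono_fun_compose[OF mono lim cont less_add_one this]
  have "(\<lambda>Q. h Q (real Q ^ 2 / N Q * (t / real k))) \<longlonglongrightarrow>
      6 / pi\<^sup>2 * (hyperbola_area (pi\<^sup>2 / 3 * (t / real k)) / real k)"
    .
  from tendsto_mult[OF this N_lim]
  have "(\<lambda>Q. h Q (real Q ^ 2 / N Q * (t / real k)) * (real Q ^ 2 / N Q)) \<longlonglongrightarrow>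
      2 * hyperbola_area (pi\<^sup>2 * t / (3 * real k)) / real k"
    by (simp add: field_simps)
  moreover have "\<forall>\<^sub>F Q in sequentially. h Q (real Q ^ 2 / N Q * (t / real k)) * (real Q ^ 2 / N Q) =
      real (card (coordinate_pairs Q (N Q) t k j)) / N Q"
    using eventually_card_farey_ge
  proof eventually_elim
    case (elim Q)
    then have "N Q > 0" unfolding N_def by (smt (verit) divide_pos_pos of_nat_0_less_iff zero_less_power)
    moreover have s: "real Q ^ 2 / N Q * (t / real k) = t * real Q ^ 2 / (N Q * real k)" by simp
    ultimately show ?case
      using coordinate_pairs_eq_lattice_points[of Q "N Q" k t j] elim assms unfolding h_def s by simp
  qed
  ultimately show ?thesis unfolding N_def by (rule Lim_transform_eventually)
qed

definition farey_gap_limit :: "nat \<Rightarrow> real \<Rightarrow> real" where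
  "farey_gap_limit K t = (\<Sum>k\<in>{1..K}. 2 * real (totient k) / real k * hyperbola_area (pi\<^sup>2 * t / (3 * real k)))"

text \<open>The factor \<open>6\<close> comes from \<open>N \<ge> Q\<^sup>2 / 6\<close> for large \<open>Q\<close>: it bounds the determinants of the pairs at
distance at most \<open>t / N\<close> by \<open>t Q\<^sup>2 / N \<le> 6 t\<close>.\<close>
lemma farey_gap_ratio_tendsto:
  assumes "6 * t \<le> real K"
  shows "(\<lambda>Q. farey_gap_ratio Q t) \<longlonglongrightarrow> farey_gap_limit K t"
proof -
  have "(\<lambda>Q. \<Sum>k\<in>{1..K}. \<Sum>j\<in>totatives k.
           real (card (coordinate_pairs Q (real (card (farey Q))) t k j)) / real (card (farey Q)))
      \<longlonglongrightarrow> (\<Sum>k\<in>{1..K}. \<Sum>j\<in>totatives k. 2 * hyperbola_area (pi\<^sup>2 * t / (3 * real k)) / real k)"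
    by (intro tendsto_sum tendsto_card_coordinate_pairs) auto
  also have "(\<Sum>k\<in>{1..K}. \<Sum>j\<in>totatives k. 2 * hyperbola_area (pi\<^sup>2 * t / (3 * real k)) / real k) = farey_gap_limit K t"
    by (simp add: farey_gap_limit_def totient_def mult_ac)
  finally have "(\<lambda>Q. \<Sum>k\<in>{1..K}. \<Sum>j\<in>totatives k.
           real (card (coordinate_pairs Q (real (card (farey Q))) t k j)) / real (card (farey Q)))
      \<longlonglongrightarrow> farey_gap_limit K t" .
  moreover have "\<forall>\<^sub>F Q in sequentially. (\<Sum>k\<in>{1..K}. \<Sum>j\<in>totatives k.
           real (card (coordinate_pairs Q (real (card (farey Q))) t k j)) / real (card (farey Q))) = farey_gap_ratio Q t"
    using eventually_card_farey_ge eventually_card_farey_gt[of "max 0 t"]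
  proof eventually_elim
    case (elim Q)
    define N where "N = real (card (farey Q))"
    have N: "N > 0" "t < N" "real Q ^ 2 \<le> 6 * N" using elim by (auto simp: N_def)
    have "t * real Q ^ 2 \<le> real K * N"
    proof (cases "t \<le> 0")
      case True
      then have "t * real Q ^ 2 \<le> 0" by (intro mult_nonpos_nonneg) auto
      also have "0 \<le> real K * N" using N by simp
      finally show ?thesis .
    next
      case False
      then have "t * real Q ^ 2 \<le> t * (6 * N)" using N by (intro mult_left_mono) auto
      also have "\<dots> \<le> real K * N" using mult_right_mono[OF assms, of N] N by (simp add: mult_ac)
      finally show ?thesis .
    qed
    then have "card {(x, y). x \<in> farey Q \<and> y \<in> farey Q \<and> x \<noteq> y \<and> N * frac (x - y) \<le> t} =
         (\<Sum>k\<in>{1..K}. \<Sum>j\<in>totatives k. card (coordinate_pairs Q N t k j))"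
      by (rule card_farey_pairs[OF N(1,2)])
    then show ?case by (simp add: farey_gap_ratio_def N_def[symmetric] sum_divide_distrib)
  qed
  ultimately show ?thesis by (rule Lim_transform_eventually)
qed

text \<open>A range of summation independent of \<open>t\<close>, for the sake of measurability and differentiation. At
\<open>t = 0\<close> both sides vanish, since division by zero yields zero.\<close>
lemma farey_g2_eq_sum:
  assumes "0 \<le> t" "6 * t \<le> real K"
  shows "farey_g2 t = 6 / (pi\<^sup>2 * t\<^sup>2) * (\<Sum>k\<in>{1..K}. real (totient k) * max 0 (ln (pi\<^sup>2 * t / (3 * real k))))"
proof -
  have "pi\<^sup>2 \<le> 4\<^sup>2" using pi_less_4 pi_gt_zero by (intro power_mono) auto
  then have "pi\<^sup>2 * t \<le> 16 * t" using assms by (intro mult_right_mono) auto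
  then have bound: "pi\<^sup>2 * t / 3 \<le> real K" using assms by simp
  have "(\<Sum>k | 1 \<le> k \<and> real k < pi\<^sup>2 * t / 3. real (totient k) * ln (pi\<^sup>2 * t / (3 * real k))) =
        (\<Sum>k | 1 \<le> k \<and> real k < pi\<^sup>2 * t / 3. real (totient k) * max 0 (ln (pi\<^sup>2 * t / (3 * real k))))"
    by (intro sum.cong refl) (auto simp: field_simps)
  also have "\<dots> = (\<Sum>k\<in>{1..K}. real (totient k) * max 0 (ln (pi\<^sup>2 * t / (3 * real k))))"
  proof (rule sum.mono_neutral_left)
    show "{k. 1 \<le> k \<and> real k < pi\<^sup>2 * t / 3} \<subseteq> {1..K}" using bound by auto
    show "\<forall>k\<in>{1..K} - {k. 1 \<le> k \<and> real k < pi\<^sup>2 * t / 3}. real (totient k) * max 0 (ln (pi\<^sup>2 * t / (3 * real k))) = 0"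
    proof
      fix k assume k: "k \<in> {1..K} - {k. 1 \<le> k \<and> real k < pi\<^sup>2 * t / 3}"
      then have "pi\<^sup>2 * t / (3 * real k) \<le> 1" by (auto simp: field_simps)
      moreover have "0 \<le> pi\<^sup>2 * t / (3 * real k)" using assms by simp
      ultimately have "ln (pi\<^sup>2 * t / (3 * real k)) \<le> 0"
        by (metis ln_le_zero_iff ln_0 order_le_less order_refl)
      then show "real (totient k) * max 0 (ln (pi\<^sup>2 * t / (3 * real k))) = 0" by simp
    qed
  qed simp
  finally show ?thesis by (simp only: farey_g2_def)
qed

lemma farey_gap_limit_deriv:
  assumes "0 \<le> t" "6 * t \<le> real K"
  shows "(farey_gap_limit K has_real_derivative farey_g2 t) (at t)"
proof -
  have "((\<lambda>t. 2 * real (totient k) / real k * hyperbola_area (pi\<^sup>2 * t / (3 * real k))) has_real_derivative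
      6 / (pi\<^sup>2 * t\<^sup>2) * (real (totient k) * max 0 (ln (pi\<^sup>2 * t / (3 * real k))))) (at t)" if "k \<in> {1..K}" for k
  proof -
    let ?c = "pi\<^sup>2 / (3 * real k)"
    have lin: "((\<lambda>t. ?c * t) has_real_derivative ?c) (at t)"
      using that by (auto intro!: derivative_eq_intros)
    have "((\<lambda>t. hyperbola_area (?c * t)) has_real_derivative max 0 (ln (?c * t)) / (?c * t)\<^sup>2 * ?c) (at t)"
      by (rule DERIV_chain2[OF hyperbola_area_deriv lin]) (use assms in simp)
    from DERIV_cmult[OF this, of "2 * real (totient k) / real k"]
    have "((\<lambda>t. 2 * real (totient k) / real k * hyperbola_area (?c * t)) has_real_derivative
       2 * real (totient k) / real k * (max 0 (ln (?c * t)) / (?c * t)\<^sup>2 * ?c)) (at t)" .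
    moreover have "2 * real (totient k) / real k * (m / (?c * t)\<^sup>2 * ?c) =
       6 / (pi\<^sup>2 * t\<^sup>2) * (real (totient k) * m)" for m
      using that by (cases "t = 0") (auto simp: field_simps power2_eq_square)
    ultimately show ?thesis by simp
  qed
  then have "(farey_gap_limit K has_real_derivative
     (\<Sum>k\<in>{1..K}. 6 / (pi\<^sup>2 * t\<^sup>2) * (real (totient k) * max 0 (ln (pi\<^sup>2 * t / (3 * real k)))))) (at t)"
    unfolding farey_gap_limit_def by (rule DERIV_sum)
  then show ?thesis by (simp only: farey_g2_eq_sum[OF assms] sum_distrib_left)
qed

text \<open>The interval may contain each of its endpoints or not; they form a null set.\<close>
lemma integral_farey_g2:
  assumes ab: "0 \<le> \<alpha>" "\<alpha> \<le> \<beta>" "6 * \<beta> \<le> real K"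
    and I: "{\<alpha><..<\<beta>} \<subseteq> I" "I \<subseteq> {\<alpha>..\<beta>}"
  shows "set_integrable lborel I farey_g2"
    and "(LINT x:I|lborel. farey_g2 x) = farey_gap_limit K \<beta> - farey_gap_limit K \<alpha>"
proof -
  define g where "g t = 6 / (pi\<^sup>2 * t\<^sup>2) * (\<Sum>k\<in>{1..K}. real (totient k) * max 0 (ln (pi\<^sup>2 * t / (3 * real k))))" for t
  have g_eq: "farey_g2 t = g t" if "t \<in> {\<alpha>..\<beta>}" for t
    using that ab unfolding g_def by (intro farey_g2_eq_sum) auto
  have full: "has_bochner_integral lborel (\<lambda>x. g x * indicator {\<alpha>..\<beta>} x) (farey_gap_limit K \<beta> - farey_gap_limit K \<alpha>)"
  proof (rule has_bochner_integral_FTC_Icc_nonneg)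
    show "g \<in> borel_measurable borel" unfolding g_def by measurable
    show "(farey_gap_limit K has_real_derivative g x) (at x)" if "x \<in> {\<alpha>..\<beta>}" for x
      using farey_gap_limit_deriv[of x K] g_eq[OF that] that ab by auto
    show "0 \<le> g x" for x unfolding g_def by (intro mult_nonneg_nonneg sum_nonneg) auto
  qed fact
  have "I = {\<alpha><..<\<beta>} \<union> (I \<inter> {\<alpha>, \<beta>})" using I by fastforce
  moreover have "{\<alpha><..<\<beta>} \<union> (I \<inter> {\<alpha>, \<beta>}) \<in> sets borel"
    by (intro sets.Un borel_open borel_closed finite_imp_closed) auto
  ultimately have I_borel: "I \<in> sets borel" by simp
  have eq: "indicator I x *\<^sub>R farey_g2 x = indicator I x * (g x * indicator {\<alpha>..\<beta>} x)" for x
    using I g_eq[of x] by (auto simp: indicator_def)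
  have "has_bochner_integral lborel (\<lambda>x. indicator I x *\<^sub>R farey_g2 x) (farey_gap_limit K \<beta> - farey_gap_limit K \<alpha>)"
  proof (rule has_bochner_integral_cong_AE[THEN iffD1, OF _ _ _ full])
    show meas: "(\<lambda>x. g x * indicator {\<alpha>..\<beta>} x) \<in> borel_measurable lborel"
      using full by (auto simp: has_bochner_integral_iff)
    show "(\<lambda>x. indicator I x *\<^sub>R farey_g2 x) \<in> borel_measurable lborel"
      unfolding eq using meas I_borel by (intro borel_measurable_times[OF borel_measurable_indicator meas]) auto
    show "AE x in lborel. g x * indicator {\<alpha>..\<beta>} x = indicator I x *\<^sub>R farey_g2 x"
      using AE_lborel_singleton[of \<alpha>] AE_lborel_singleton[of \<beta>]
    proof eventually_elim
      case (elim x)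
      then have "x \<in> {\<alpha>..\<beta>} \<longleftrightarrow> x \<in> I" using I by auto
      then show ?case unfolding eq by (auto simp: indicator_def)
    qed
  qed
  then show "set_integrable lborel I farey_g2"
    and "(LINT x:I|lborel. farey_g2 x) = farey_gap_limit K \<beta> - farey_gap_limit K \<alpha>"
    by (auto simp: has_bochner_integral_iff set_integrable_def set_lebesgue_integral_def)
qed

text \<open>Once \<open>N\<close> exceeds all elements of \<open>I\<close>, the only \<open>t\<close> that can witness the membership of a
pair is \<open>N * frac (x - y)\<close>.\<close>
lemma pair_correlation_farey_eq:
  assumes "I \<subseteq> {0<..}" "\<And>t. t \<in> I \<Longrightarrow> t < real (card (farey Q))"
  shows "pair_correlation (farey Q) I =
     real (card {(x, y). x \<in> farey Q \<and> y \<in> farey Q \<and> x \<noteq> y \<and> real (card (farey Q)) * frac (x - y) \<in> I})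
       / real (card (farey Q))"
proof -
  define N where "N = real (card (farey Q))"
  have "(\<exists>t\<in>I. \<exists>m::int. z = t / N + of_int m) \<longleftrightarrow> N * frac z \<in> I" for z
  proof
    assume "\<exists>t\<in>I. \<exists>m::int. z = t / N + of_int m"
    then obtain t m where t: "t \<in> I" "z = t / N + of_int m" by blast
    have "0 < t" "t < N" using t assms by (auto simp: N_def)
    then have "frac z = t / N" unfolding t(2) by (simp add: frac_eq)
    then show "N * frac z \<in> I" using t \<open>0 < t\<close> \<open>t < N\<close> by simp
  next
    assume *: "N * frac z \<in> I"
    then have "N \<noteq> 0" using assms(1) by auto
    then have "N > 0" by (simp add: N_def)
    then have "z = (N * frac z) / N + of_int \<lfloor>z\<rfloor>" by (simp add: frac_def)
    then show "\<exists>t\<in>I. \<exists>m::int. z = t / N + of_int m" using * by blast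
  qed
  then show ?thesis by (simp add: pair_correlation_def N_def)
qed

text \<open>Whichever endpoints belong to \<open>I\<close>, the count for \<open>I\<close> lies between the counts for the half-open intervals
from \<open>\<alpha>\<close> to \<open>\<beta> - 1 / (Q + 1)\<close> and from \<open>\<alpha> - 1 / (Q + 1)\<close> to \<open>\<beta>\<close>, open on the left.\<close>
lemma pair_correlation_farey_tendsto:
  assumes ab: "0 \<le> \<alpha>" "\<alpha> \<le> \<beta>" "6 * (\<beta> + 1) \<le> real K"
    and I: "{\<alpha><..<\<beta>} \<subseteq> I" "I \<subseteq> {\<alpha>..\<beta>}" "I \<subseteq> {0<..}"
  shows "(\<lambda>Q. pair_correlation (farey Q) I) \<longlonglongrightarrow> farey_gap_limit K \<beta> - farey_gap_limit K \<alpha>"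
proof -
  define C where "C Q = {(x, y). x \<in> farey Q \<and> y \<in> farey Q \<and> x \<noteq> y \<and> real (card (farey Q)) * frac (x - y) \<in> I}" for Q
  define R where "R Q t = {(x, y). x \<in> farey Q \<and> y \<in> farey Q \<and> x \<noteq> y \<and> real (card (farey Q)) * frac (x - y) \<le> t}" for Q t
  have fin: "finite (C Q)" "finite (R Q t)" for Q t
    unfolding C_def R_def by (rule finite_farey_pairs)+
  have pc: "\<forall>\<^sub>F Q in sequentially. pair_correlation (farey Q) I = real (card (C Q)) / real (card (farey Q))"
    using eventually_card_farey_gt[of \<beta>]
  proof eventually_elim
    case (elim Q)
    show ?case unfolding C_def by (rule pair_correlation_farey_eq) (use I elim in auto)
  qed
  have lim: "(\<lambda>Q. farey_gap_ratio Q (X Q)) \<longlonglongrightarrow> farey_gap_limit K t"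
    if "X \<longlonglongrightarrow> t" "0 \<le> t" "t \<le> \<beta>" for X t
  proof (rule tendsto_mono_fun_compose[OF mono_farey_gap_ratio _ _ _ that(1)])
    show "(\<lambda>Q. farey_gap_ratio Q y) \<longlonglongrightarrow> farey_gap_limit K y" if "y < \<beta> + 1" for y
      by (rule farey_gap_ratio_tendsto) (use that ab in simp)
    show "isCont (farey_gap_limit K) t"
      by (rule DERIV_isCont[OF farey_gap_limit_deriv]) (use that ab in auto)
  qed (use that in auto)
  have shift: "(\<lambda>Q. t - inverse (real (Suc Q))) \<longlonglongrightarrow> t" for t
    using tendsto_diff[OF tendsto_const LIMSEQ_inverse_real_of_nat, of t] by simp
  have lower_lim: "(\<lambda>Q. farey_gap_ratio Q (\<beta> - inverse (real (Suc Q))) - farey_gap_ratio Q \<alpha>)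
      \<longlonglongrightarrow> farey_gap_limit K \<beta> - farey_gap_limit K \<alpha>"
    using ab by (intro tendsto_diff lim shift tendsto_const) auto
  have upper_lim: "(\<lambda>Q. farey_gap_ratio Q \<beta> - farey_gap_ratio Q (\<alpha> - inverse (real (Suc Q))))
      \<longlonglongrightarrow> farey_gap_limit K \<beta> - farey_gap_limit K \<alpha>"
    using ab by (intro tendsto_diff lim shift tendsto_const) auto
  have lower: "farey_gap_ratio Q (\<beta> - inverse (real (Suc Q))) - farey_gap_ratio Q \<alpha> \<le>
        real (card (C Q)) / real (card (farey Q))" for Q
  proof -
    have "x \<in> I" if "x \<le> \<beta> - inverse (real (Suc Q))" "\<not> x \<le> \<alpha>" for x
    proof -
      have "0 < inverse (real (Suc Q))" by simp
      then have "x < \<beta>" using that(1) by linarith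
      then show ?thesis using that(2) I(1) by auto
    qed
    then have "R Q (\<beta> - inverse (real (Suc Q))) \<subseteq> R Q \<alpha> \<union> C Q"
      unfolding R_def C_def by blast
    then have "card (R Q (\<beta> - inverse (real (Suc Q)))) \<le> card (R Q \<alpha> \<union> C Q)"
      by (intro card_mono) (auto simp: fin)
    also have "\<dots> \<le> card (R Q \<alpha>) + card (C Q)" by (rule card_Un_le)
    finally show ?thesis
      unfolding farey_gap_ratio_def R_def[symmetric] by (simp add: divide_right_mono flip: diff_divide_distrib)
  qed
  have upper: "real (card (C Q)) / real (card (farey Q)) \<le>
      farey_gap_ratio Q \<beta> - farey_gap_ratio Q (\<alpha> - inverse (real (Suc Q)))" for Q
  proof -
    have e: "0 < inverse (real (Suc Q))" by simp
    have "x \<le> \<beta> \<and> \<not> x \<le> \<alpha> - inverse (real (Suc Q))" if "x \<in> I" for x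
    proof -
      have "\<alpha> \<le> x" "x \<le> \<beta>" using I(2) that by auto
      then show ?thesis using e by linarith
    qed
    moreover have "x \<le> \<beta>" if "x \<le> \<alpha> - inverse (real (Suc Q))" for x
      using that e ab by linarith
    ultimately have "C Q \<inter> R Q (\<alpha> - inverse (real (Suc Q))) = {}" "C Q \<union> R Q (\<alpha> - inverse (real (Suc Q))) \<subseteq> R Q \<beta>"
      unfolding R_def C_def by blast+
    then have "card (C Q) + card (R Q (\<alpha> - inverse (real (Suc Q)))) \<le> card (R Q \<beta>)"
      by (metis card_Un_disjoint card_mono fin)
    then have "real (card (C Q)) \<le> real (card (R Q \<beta>)) - real (card (R Q (\<alpha> - inverse (real (Suc Q)))))" by linarith
    then show ?thesis
      unfolding farey_gap_ratio_def R_def[symmetric] by (simp add: divide_right_mono flip: diff_divide_distrib)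
  qed
  have "(\<lambda>Q. real (card (C Q)) / real (card (farey Q))) \<longlonglongrightarrow> farey_gap_limit K \<beta> - farey_gap_limit K \<alpha>"
    by (rule tendsto_sandwich[OF always_eventually always_eventually lower_lim upper_lim])
       (intro allI lower upper)+
  then show ?thesis
  proof (rule Lim_transform_eventually)
    show "\<forall>\<^sub>F Q in sequentially. real (card (C Q)) / real (card (farey Q)) = pair_correlation (farey Q) I"
      using pc by eventually_elim simp
  qed
qed

theorem theorem2:
  shows "pair_correlation_function_on {0<..} farey farey_g2 \<and>
         (\<lambda>l. farey_g2 l - 1) \<in> O[at_top](\<lambda>l. 1 / l)"
proof
  show "pair_correlation_function_on {0<..} farey farey_g2"
    unfolding pair_correlation_function_on_def
  proof (intro conjI allI impI)
    show "incseq farey" by (rule incseq_farey)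
    show "finite (farey n)" for n by (rule finite_farey)
    show "farey n \<subseteq> {0..1}" for n using farey_subset[of n] by auto
    fix I :: "real set" assume I: "is_interval I" "bounded I" "I \<subseteq> {0<..}"
    have "\<exists>\<alpha> \<beta>. 0 \<le> \<alpha> \<and> \<alpha> \<le> \<beta> \<and> {\<alpha><..<\<beta>} \<subseteq> I \<and> I \<subseteq> {\<alpha>..\<beta>}"
    proof (cases "I = {}")
      case True
      then show ?thesis by (intro exI[of _ "0::real"] exI[of _ "0::real"]) auto
    next
      case False
      have bdd: "bdd_above I" "bdd_below I" using I(2) by (auto intro: bounded_imp_bdd_above bounded_imp_bdd_below)
      have sub: "I \<subseteq> {Inf I..Sup I}" using bdd by (auto intro: cInf_lower cSup_upper)
      moreover have "{Inf I<..<Sup I} \<subseteq> I"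
      proof
        fix x assume "x \<in> {Inf I<..<Sup I}"
        then obtain y z where "y \<in> I" "y < x" "z \<in> I" "x < z"
          using False bdd by (auto simp: cInf_less_iff less_cSup_iff)
        then show "x \<in> I" using I(1) by (meson is_interval_1 less_imp_le)
      qed
      moreover have "0 \<le> Inf I" using False I(3) by (intro cInf_greatest) auto
      moreover have "Inf I \<le> Sup I" using sub False by force
      ultimately show ?thesis by blast
    qed
    then obtain \<alpha> \<beta> where ab: "0 \<le> \<alpha>" "\<alpha> \<le> \<beta>" "{\<alpha><..<\<beta>} \<subseteq> I" "I \<subseteq> {\<alpha>..\<beta>}" by blast
    define K where "K = nat \<lceil>6 * (\<beta> + 1)\<rceil>"
    have K: "6 * (\<beta> + 1) \<le> real K" unfolding K_def by linarith
    have K': "6 * \<beta> \<le> real K" using K by simp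
    show "set_integrable lborel I farey_g2" by (rule integral_farey_g2(1)[OF ab(1,2) K' ab(3,4)])
    show "(\<lambda>n. pair_correlation (farey n) I) \<longlonglongrightarrow> (LINT x:I|lborel. farey_g2 x)"
      unfolding integral_farey_g2(2)[OF ab(1,2) K' ab(3,4)]
      by (rule pair_correlation_farey_tendsto[OF ab(1,2) K ab(3,4) I(3)])
  qed
  show "(\<lambda>l. farey_g2 l - 1) \<in> O[at_top](\<lambda>l. 1 / l)"
    by (rule farey_g2_bigo)
qed

end
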